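(* Let $\mathfrak{C}$ be the comb graph. The transition group $G=\mathcal{G}(\mathfrak{C})$ is isomorphic to the wreath product $\mathbb{Z}\wr\mathbb{Z}$. In particular, $G$ is not finitely presented, is solvable, and contains a copy of the free abelian group $\mathbb{Z}^\infty$ of countably infinite rank. Hence $G$ is not poly-context-free.
   Context: The transition group $\mathcal{G}(\Gamma)$ of a connected directed graph $\Gamma$ whose edges are labeled by a finite alphabet $A$ closed under inversion, with each edge $v\xrightarrow{x}w$ having an inverse edge $w\xrightarrow{x^{-1}}v$, and with exactly one outgoing $x$-edge at every vertex for every $x\in A$, is the group of permutations of the vertex set generated by the permutations $v\mapsto v\cdot x$ ($x\in A$), where $v\cdot x$ is the endpoint of the $x$-edge at $v$. The comb graph $\mathfrak{C}$ is the graph over $\{a^{\pm1},c^{\pm1}\}$ with vertices $z_i^{(j)}$, $i,j\in\mathbb{Z}$, and edges (together with their inverses) $z_i^{(j)}\xrightarrow{c}z_{i+1}^{(j)}$ for all $i,j\in\mathbb{Z}$; $z_0^{(j)}\xrightarrow{a}z_0^{(j+1)}$ for all $j\in\mathbb{Z}$; and loops $z_i^{(j)}\xrightarrow{a}z_i^{(j)}$ for all $j\in\mathbb{Z}$ and $i\ne0$. (It is an $a$-line with a $c$-line attached at each of its vertices, and $a$-loops at all vertices off the $a$-line.) A finitely generated group is poly-context-free if its word problem (the set of words over a finite symmetric generating set representing the identity) is an intersection of finitely many context-free languages. $\mathbb{Z}\wr\mathbb{Z}$ is the restricted wreath product $\left(\bigoplus_{\mathbb{Z}}\mathbb{Z}\right)\rtimes\mathbb{Z}$.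 *)

theory Defs
  imports
    "HOL-Algebra.Bij"
    "HOL-Algebra.Solvable_Groups"
    "HOL-Algebra.Free_Abelian_Groups"
begin

section \<open>Labeled graphs and their transition groups\<close>

text \<open>An edge \<open>(v, x, w)\<close> goes from \<open>v\<close> to \<open>w\<close> and carries the label \<open>x\<close>; the map
  \<open>inv_label\<close> is the formal inversion \<open>x \<mapsto> x\<^sup>-\<^sup>1\<close> on the alphabet.\<close>

record ('v, 'x) labeled_graph =
  verts :: "'v set"
  labels :: "'x set"
  inv_label :: "'x \<Rightarrow> 'x"
  edges :: "('v \<times> 'x \<times> 'v) set"

locale transition_graph =
  fixes \<Gamma> :: "('v, 'x) labeled_graph"
  assumes finite_labels: "finite (labels \<Gamma>)"
    and inv_label_closed: "x \<in> labels \<Gamma> \<Longrightarrow> inv_label \<Gamma> x \<in> labels \<Gamma>"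
    and inv_label_inv_label: "x \<in> labels \<Gamma> \<Longrightarrow> inv_label \<Gamma> (inv_label \<Gamma> x) = x"
    and edges_subset: "edges \<Gamma> \<subseteq> verts \<Gamma> \<times> labels \<Gamma> \<times> verts \<Gamma>"
    and inverse_edge: "(v, x, w) \<in> edges \<Gamma> \<Longrightarrow> (w, inv_label \<Gamma> x, v) \<in> edges \<Gamma>"
    and unique_edge: "\<lbrakk>v \<in> verts \<Gamma>; x \<in> labels \<Gamma>\<rbrakk> \<Longrightarrow> \<exists>!w. (v, x, w) \<in> edges \<Gamma>"
    and nonempty: "verts \<Gamma> \<noteq> {}"
    and connected: "\<lbrakk>v \<in> verts \<Gamma>; w \<in> verts \<Gamma>\<rbrakk> \<Longrightarrow>
      (v, w) \<in> {(u, u'). \<exists>x. (u, x, u') \<in> edges \<Gamma>}\<^sup>*"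

definition target :: "('v, 'x) labeled_graph \<Rightarrow> 'v \<Rightarrow> 'x \<Rightarrow> 'v" where
  "target \<Gamma> v x = (THE w. (v, x, w) \<in> edges \<Gamma>)"

definition transition_perm :: "('v, 'x) labeled_graph \<Rightarrow> 'x \<Rightarrow> 'v \<Rightarrow> 'v" where
  "transition_perm \<Gamma> x = (\<lambda>v\<in>verts \<Gamma>. target \<Gamma> v x)"

text \<open>Multiplication in \<open>BijGroup\<close> is composition from right to left. Reading words as a
  right action gives the opposite group, which is isomorphic via inversion.\<close>

definition transition_group :: "('v, 'x) labeled_graph \<Rightarrow> ('v \<Rightarrow> 'v) monoid" where
  "transition_group \<Gamma> =
     subgroup_generated (BijGroup (verts \<Gamma>)) (transition_perm \<Gamma> ` labels \<Gamma>)"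

context transition_graph
begin

lemma target_edge:
  assumes "v \<in> verts \<Gamma>" "x \<in> labels \<Gamma>"
  shows "(v, x, target \<Gamma> v x) \<in> edges \<Gamma>"
  unfolding target_def by (rule theI'[OF unique_edge[OF assms]])

lemma target_eqI:
  assumes "(v, x, w) \<in> edges \<Gamma>"
  shows "target \<Gamma> v x = w"
  using assms target_edge unique_edge edges_subset by blast

lemma target_closed:
  assumes "v \<in> verts \<Gamma>" "x \<in> labels \<Gamma>"
  shows "target \<Gamma> v x \<in> verts \<Gamma>"
  using target_edge[OF assms] edges_subset by blast

lemma target_inverse:
  assumes "v \<in> verts \<Gamma>" "x \<in> labels \<Gamma>"
  shows "target \<Gamma> (target \<Gamma> v x) (inv_label \<Gamma> x) = v"
  by (rule target_eqI[OF inverse_edge[OF target_edge[OF assms]]])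

text \<open>Hence \<open>subgroup_generated\<close>, which intersects the given set with the carrier, discards
  none of the generators.\<close>

lemma transition_perm_in_BijGroup:
  assumes x: "x \<in> labels \<Gamma>"
  shows "transition_perm \<Gamma> x \<in> carrier (BijGroup (verts \<Gamma>))"
proof -
  have "bij_betw (\<lambda>v. target \<Gamma> v x) (verts \<Gamma>) (verts \<Gamma>)"
  proof (rule bij_betwI[where g = "\<lambda>v. target \<Gamma> v (inv_label \<Gamma> x)"])
    show "target \<Gamma> (target \<Gamma> v (inv_label \<Gamma> x)) x = v" if "v \<in> verts \<Gamma>" for v
      using target_inverse[OF that inv_label_closed[OF x]] inv_label_inv_label[OF x] by simp
  qed (use x target_closed target_inverse inv_label_closed in auto)
  then show ?thesis
    by (simp add: BijGroup_def Bij_def transition_perm_def bij_betw_restrict_eq)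
qed

end

section \<open>The comb graph\<close>

text \<open>A letter is a generator with an exponent sign: \<open>(x, True)\<close> stands for \<open>x\<close> and
  \<open>(x, False)\<close> for its formal inverse.\<close>

type_synonym 'x letter = "'x \<times> bool"

definition inv_letter :: "'x letter \<Rightarrow> 'x letter" where
  "inv_letter l = (fst l, \<not> snd l)"

lemma inv_letter_simps [simp]:
  "inv_letter (x, b) = (x, \<not> b)" "inv_letter (inv_letter l) = l" "fst (inv_letter l) = fst l"
  by (simp_all add: inv_letter_def)

datatype comb_gen = Gen_a | Gen_c

text \<open>The vertex \<open>z\<^sub>i\<^sup>(\<^sup>j\<^sup>)\<close> is the pair \<open>(i, j)\<close>.\<close>

definition comb_pos_edges :: "((int \<times> int) \<times> comb_gen letter \<times> (int \<times> int)) set" where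
  "comb_pos_edges =
     {((i, j), (Gen_c, True), (i + 1, j)) | i j. True} \<union>
     {((0, j), (Gen_a, True), (0, j + 1)) | j. True} \<union>
     {((i, j), (Gen_a, True), (i, j)) | i j. i \<noteq> 0}"

definition comb_graph :: "(int \<times> int, comb_gen letter) labeled_graph" where
  "comb_graph =
     \<lparr>verts = UNIV, labels = UNIV, inv_label = inv_letter,
      edges = comb_pos_edges \<union> {(w, inv_letter x, v) | v x w. (v, x, w) \<in> comb_pos_edges}\<rparr>"

lemma comb_pos_edges_iff:
  "(v, x, w) \<in> comb_pos_edges \<longleftrightarrow>
     snd x \<and>
     w = (case fst x of
            Gen_c \<Rightarrow> (fst v + 1, snd v)
          | Gen_a \<Rightarrow> (fst v, if fst v = 0 then snd v + 1 else snd v))"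
proof -
  obtain i j where v: "v = (i, j)" by (cases v)
  obtain g b where x: "x = (g, b)" by (cases x)
  show ?thesis
    unfolding v x comb_pos_edges_def by (cases g) auto
qed

lemma comb_edges_iff:
  "(v, x, w) \<in> edges comb_graph \<longleftrightarrow>
     (let s = (if snd x then 1 else -1) in
      w = (case fst x of
             Gen_c \<Rightarrow> (fst v + s, snd v)
           | Gen_a \<Rightarrow> (fst v, if fst v = 0 then snd v + s else snd v)))"
proof -
  have "(\<exists>y. x = inv_letter y \<and> (w, y, v) \<in> comb_pos_edges) \<longleftrightarrow>
      (w, inv_letter x, v) \<in> comb_pos_edges"
    by (metis inv_letter_simps(2))
  then have "(v, x, w) \<in> edges comb_graph \<longleftrightarrow>
      (v, x, w) \<in> comb_pos_edges \<or> (w, inv_letter x, v) \<in> comb_pos_edges"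
    unfolding comb_graph_def by (cases v; cases w) auto
  then show ?thesis
    by (cases "fst x"; cases "snd x")
      (auto simp: comb_pos_edges_iff inv_letter_def prod_eq_iff)
qed

lemma UNIV_comb_gen: "UNIV = {Gen_a, Gen_c}"
  by (auto intro: comb_gen.exhaust)

lemma transition_graph_comb: "transition_graph comb_graph"
proof
  let ?R = "{(u, u'). \<exists>x. (u, x, u') \<in> edges comb_graph}"
  have R: "(v, x, w) \<in> edges comb_graph \<Longrightarrow> (v, w) \<in> ?R" for v x w
    by blast
  have c: "((i, j), (i + 1, j)) \<in> ?R" "((i + 1, j), (i, j)) \<in> ?R" for i j :: int
    by (rule R[of _ "(Gen_c, True)"] R[of _ "(Gen_c, False)"],
        simp add: comb_edges_iff)+
  have a: "((0, j), (0, j + 1)) \<in> ?R" "((0, j + 1), (0, j)) \<in> ?R" for j :: int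
    by (rule R[of _ "(Gen_a, True)"] R[of _ "(Gen_a, False)"],
        simp add: comb_edges_iff)+
  have C: "((0, j), (i, j)) \<in> ?R\<^sup>* \<and> ((i, j), (0, j)) \<in> ?R\<^sup>*" for i j :: int
  proof (induction i rule: int_induct[where k = 0])
    case (step1 i)
    then show ?case
      using rtrancl.rtrancl_into_rtrancl[OF _ c(1)[of i j]]
        converse_rtrancl_into_rtrancl[OF c(2)[of i j]] by blast
  next
    case (step2 i)
    then show ?case
      using rtrancl.rtrancl_into_rtrancl[OF _ c(2)[of "i - 1" j]]
        converse_rtrancl_into_rtrancl[OF c(1)[of "i - 1" j]] by (simp del: mem_Collect_eq)
  qed simp
  have A: "((0, 0), (0, j)) \<in> ?R\<^sup>* \<and> ((0, j), (0, 0)) \<in> ?R\<^sup>*" for j :: int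
  proof (induction j rule: int_induct[where k = 0])
    case (step1 j)
    then show ?case
      using rtrancl.rtrancl_into_rtrancl[OF _ a(1)[of j]]
        converse_rtrancl_into_rtrancl[OF a(2)[of j]] by blast
  next
    case (step2 j)
    then show ?case
      using rtrancl.rtrancl_into_rtrancl[OF _ a(2)[of "j - 1"]]
        converse_rtrancl_into_rtrancl[OF a(1)[of "j - 1"]] by (simp del: mem_Collect_eq)
  qed simp
  show "(v, w) \<in> ?R\<^sup>*" for v w
    using C[of "snd v" "fst v"] A[of "snd v"] A[of "snd w"] C[of "snd w" "fst w"]
    by (metis (no_types, lifting) prod.collapse rtrancl_trans)
  show "finite (labels comb_graph)"
    by (simp add: comb_graph_def UNIV_comb_gen finite_prod)
  show "\<exists>!w. (v, x, w) \<in> edges comb_graph" for v x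
    by (auto simp: comb_edges_iff Let_def)
  show "(w, inv_label comb_graph x, v) \<in> edges comb_graph"
    if "(v, x, w) \<in> edges comb_graph" for v x w
  proof -
    have "inv_label comb_graph x = (fst x, \<not> snd x)"
      by (simp add: comb_graph_def inv_letter_def)
    then show ?thesis
      using that
      by (cases v; cases w; cases "fst x"; cases "snd x") (auto simp: comb_edges_iff split: if_splits)
  qed
qed (auto simp: comb_graph_def)

section \<open>Restricted wreath products\<close>

definition semidirect_product ::
  "('a, 'c) monoid_scheme \<Rightarrow> ('b, 'd) monoid_scheme \<Rightarrow> ('b \<Rightarrow> 'a \<Rightarrow> 'a) \<Rightarrow> ('a \<times> 'b) monoid" where
  "semidirect_product N H \<phi> =
     \<lparr>carrier = carrier N \<times> carrier H,
      monoid.mult = (\<lambda>(n, h) (n', h'). (n \<otimes>\<^bsub>N\<^esub> \<phi> h n', h \<otimes>\<^bsub>H\<^esub> h')),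
      one = (\<one>\<^bsub>N\<^esub>, \<one>\<^bsub>H\<^esub>)\<rparr>"

text \<open>The acting group translates the coordinates of the direct sum.\<close>

definition wreath_product ::
  "('a, 'c) monoid_scheme \<Rightarrow> ('b, 'd) monoid_scheme \<Rightarrow> (('b \<Rightarrow> 'a) \<times> 'b) monoid" where
  "wreath_product A H =
     semidirect_product (sum_group (carrier H) (\<lambda>_. A)) H
       (\<lambda>h f. \<lambda>x\<in>carrier H. f (inv\<^bsub>H\<^esub> h \<otimes>\<^bsub>H\<^esub> x))"

section \<open>Finitely presented groups\<close>

text \<open>The free group on \<open>S\<close> is realized on reduced words. For a reduced word \<open>w\<close>,
  \<open>cons_letter l w\<close> is the reduced form of \<open>l # w\<close>.\<close>

definition reduced :: "'x letter list \<Rightarrow> bool" where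
  "reduced w \<longleftrightarrow> successively (\<lambda>l m. m \<noteq> inv_letter l) w"

fun cons_letter :: "'x letter \<Rightarrow> 'x letter list \<Rightarrow> 'x letter list" where
  "cons_letter l [] = [l]"
| "cons_letter l (m # w) = (if m = inv_letter l then w else l # m # w)"

definition free_group :: "'x set \<Rightarrow> 'x letter list monoid" where
  "free_group S =
     \<lparr>carrier = {w \<in> lists (S \<times> UNIV). reduced w},
      monoid.mult = (\<lambda>u v. foldr cons_letter u v),
      one = []\<rparr>"

lemma cons_letter_closed:
  assumes "l \<in> S \<times> UNIV" "w \<in> carrier (free_group S)"
  shows "cons_letter l w \<in> carrier (free_group S)"
  using assms by (cases w) (auto simp: free_group_def reduced_def successively_Cons)

lemma foldr_cons_letter_closed:
  assumes "u \<in> lists (S \<times> UNIV)" "w \<in> carrier (free_group S)"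
  shows "foldr cons_letter u w \<in> carrier (free_group S)"
  using assms by (induction u) (auto intro!: cons_letter_closed)

lemma cons_letter_cancel:
  assumes "reduced w"
  shows "cons_letter (inv_letter l) (cons_letter l w) = w"
proof (cases w)
  case (Cons m w')
  then show ?thesis using assms by (cases w') (auto simp: reduced_def)
qed simp

lemma foldr_cons_letter_cons:
  assumes "u \<in> carrier (free_group S)" "w \<in> carrier (free_group S)"
  shows "foldr cons_letter (cons_letter l u) w = cons_letter l (foldr cons_letter u w)"
proof (cases u)
  case (Cons m u')
  then have "foldr cons_letter u' w \<in> carrier (free_group S)"
    using assms by (intro foldr_cons_letter_closed) (auto simp: free_group_def)
  then have "reduced (foldr cons_letter u' w)" by (simp add: free_group_def)
  then show ?thesis
    using Cons cons_letter_cancel[of "foldr cons_letter u' w" "inv_letter l"] by auto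
qed simp

lemma foldr_cons_letter_assoc:
  assumes "u \<in> lists (S \<times> UNIV)" "v \<in> carrier (free_group S)" "w \<in> carrier (free_group S)"
  shows "foldr cons_letter (foldr cons_letter u v) w = foldr cons_letter u (foldr cons_letter v w)"
  using assms
  by (induction u) (auto simp: foldr_cons_letter_cons[OF foldr_cons_letter_closed])

lemma foldr_cons_letter_reduced:
  assumes "reduced w"
  shows "foldr cons_letter w [] = w"
  using assms
proof (induction w)
  case (Cons l w)
  then show ?case by (cases w) (auto simp: reduced_def)
qed simp

lemma foldr_cons_letter_left_inverse:
  assumes "u \<in> lists (S \<times> UNIV)" "w \<in> carrier (free_group S)"
  shows "foldr cons_letter (rev (map inv_letter u)) (foldr cons_letter u w) = w"
  using assms
proof (induction u)
  case (Cons l u)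
  have "reduced (foldr cons_letter u w)"
    using foldr_cons_letter_closed[of u S w] Cons by (auto simp: free_group_def)
  with Cons show ?case by (simp add: cons_letter_cancel)
qed simp

lemma group_free_group: "group (free_group S)"
proof (rule groupI)
  show "x \<otimes>\<^bsub>free_group S\<^esub> y \<in> carrier (free_group S)"
    if "x \<in> carrier (free_group S)" "y \<in> carrier (free_group S)" for x y
    using foldr_cons_letter_closed[of x S y] that by (simp add: free_group_def)
  show "x \<otimes>\<^bsub>free_group S\<^esub> y \<otimes>\<^bsub>free_group S\<^esub> z = x \<otimes>\<^bsub>free_group S\<^esub> (y \<otimes>\<^bsub>free_group S\<^esub> z)"
    if "x \<in> carrier (free_group S)" "y \<in> carrier (free_group S)" "z \<in> carrier (free_group S)"
    for x y z
    using foldr_cons_letter_assoc[of x S y z] that by (simp add: free_group_def)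
  fix x assume x: "x \<in> carrier (free_group S)"
  let ?y = "foldr cons_letter (rev (map inv_letter x)) []"
  have l: "x \<in> lists (S \<times> UNIV)" "rev (map inv_letter x) \<in> lists (S \<times> UNIV)"
    using x by (auto simp: free_group_def inv_letter_def mem_Times_iff in_lists_conv_set)
  have e: "[] \<in> carrier (free_group S)" by (simp add: free_group_def reduced_def)
  have y: "?y \<in> carrier (free_group S)"
    by (rule foldr_cons_letter_closed[OF l(2) e])
  have "foldr cons_letter ?y x = foldr cons_letter (rev (map inv_letter x)) x"
    using foldr_cons_letter_assoc[OF l(2) e x] by simp
  also have "\<dots> = []"
    using foldr_cons_letter_left_inverse[OF l(1) e] x foldr_cons_letter_reduced[of x]
    by (simp add: free_group_def)
  finally show "\<exists>y\<in>carrier (free_group S). y \<otimes>\<^bsub>free_group S\<^esub> x = \<one>\<^bsub>free_group S\<^esub>"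
    using y by (auto simp: free_group_def)
qed (auto simp: free_group_def reduced_def)

definition normal_closure :: "('a, 'b) monoid_scheme \<Rightarrow> 'a set \<Rightarrow> 'a set" where
  "normal_closure G R = \<Inter> {N. N \<lhd> G \<and> R \<subseteq> N}"

definition presented_group :: "'x set \<Rightarrow> 'x letter list set \<Rightarrow> 'x letter list set monoid" where
  "presented_group S R = free_group S Mod normal_closure (free_group S) R"

text \<open>Every finite set of generators can be renamed to a finite set of natural numbers.\<close>

definition finitely_presented :: "('a, 'b) monoid_scheme \<Rightarrow> bool" where
  "finitely_presented G \<longleftrightarrow>
     (\<exists>(S :: nat set) R. finite S \<and> finite R \<and> R \<subseteq> carrier (free_group S) \<and>
        G \<cong> presented_group S R)"

section \<open>Poly-context-free groups\<close>

text \<open>A context-free grammar is given by its productions and its start symbol; nonterminals are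
  tagged with \<open>Inl\<close> and terminals with \<open>Inr\<close>. For a finite set of productions only finitely many
  nonterminals occur, so that natural numbers suffice to name them.\<close>

type_synonym ('n, 't) production = "'n \<times> ('n + 't) list"

definition derivation_step ::
  "('n, 't) production set \<Rightarrow> (('n + 't) list \<times> ('n + 't) list) set" where
  "derivation_step P = {(u @ [Inl B] @ v, u @ \<alpha> @ v) | u v B \<alpha>. (B, \<alpha>) \<in> P}"

definition grammar_language :: "('n, 't) production set \<Rightarrow> 'n \<Rightarrow> 't list set" where
  "grammar_language P B = {w. ([Inl B], map Inr w) \<in> (derivation_step P)\<^sup>*}"

definition context_free :: "'t list set \<Rightarrow> bool" where
  "context_free L \<longleftrightarrow>
     (\<exists>(P :: (nat, 't) production set) B. finite P \<and> L = grammar_language P B)"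

definition poly_context_free_language :: "'t list set \<Rightarrow> bool" where
  "poly_context_free_language L \<longleftrightarrow>
     (\<exists>\<L>. finite \<L> \<and> \<L> \<noteq> {} \<and> (\<forall>M\<in>\<L>. context_free M) \<and> L = \<Inter> \<L>)"

definition word_value :: "('a, 'b) monoid_scheme \<Rightarrow> 'a list \<Rightarrow> 'a" where
  "word_value G w = foldr (\<lambda>x y. x \<otimes>\<^bsub>G\<^esub> y) w \<one>\<^bsub>G\<^esub>"

definition word_problem :: "('a, 'b) monoid_scheme \<Rightarrow> 'a set \<Rightarrow> 'a list set" where
  "word_problem G X = {w \<in> lists X. word_value G w = \<one>\<^bsub>G\<^esub>}"

definition symmetric_generating_set :: "('a, 'b) monoid_scheme \<Rightarrow> 'a set \<Rightarrow> bool" where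
  "symmetric_generating_set G X \<longleftrightarrow>
     X \<subseteq> carrier G \<and> (\<forall>x\<in>X. inv\<^bsub>G\<^esub> x \<in> X) \<and> generate G X = carrier G"

text \<open>The property does not depend on the choice of \<open>X\<close>. Quantifying \<open>X\<close> existentially makes the
  negation say that the word problem fails to be poly-context-free for every choice.\<close>

definition poly_context_free :: "('a, 'b) monoid_scheme \<Rightarrow> bool" where
  "poly_context_free G \<longleftrightarrow>
     (\<exists>X. finite X \<and> symmetric_generating_set G X \<and>
        poly_context_free_language (word_problem G X))"

end

theory Submission
  imports Defs
begin

text \<open>
  An element \<open>(f, s)\<close> of \<open>\<int> \<wr> \<int>\<close> acts on the vertices of the comb graph by
  \<open>(i, j) \<mapsto> (i + s, j + f (i + s))\<close>. This action is faithful, and the two generators of the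
  transition group are the images of the standard generators of the wreath product, so the action
  is an isomorphism onto the transition group (\<open>comb_perm_iso\<close>). Solvability comes from the
  abelian base group with quotient \<open>\<int>\<close>, and the functions supported on the nonnegative integers
  form a free abelian group of countably infinite rank.

  The group is not finitely presented because it is a limit of groups that fail to share its
  relations. Let the generator \<open>a\<close> act as before on column \<open>0\<close> of \<open>\<int> \<times> \<int>\<close> but also by
  another permutation on column \<open>n\<close>. Elements of \<open>\<int> \<wr> \<int>\<close> whose supports are short compared
  with \<open>n\<close> never use both columns at one place, so every fixed relation of \<open>\<int> \<wr> \<int>\<close> holds in
  the new permutation group once \<open>n\<close> is large. A finite presentation has only finitely many
  relators, hence would turn this into homomorphisms (\<open>finitely_presented_eventually_hom\<close>); but
  \<open>a\<close> and its conjugate by \<open>c\<^sup>n\<close> commute in \<open>\<int> \<wr> \<int>\<close> and do not commute in the new group.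

  No group containing \<open>\<int>\<^sup>\<infinity>\<close> is poly-context-free
  (\<open>infinite_rank_imp_not_poly_context_free\<close>). A derivation tree of a word in a context-free
  language has a subtree whose yield is a factor of moderate size, and the rest of the word
  communicates with this factor only through one nonterminal: among words that agree in the
  nonterminal and in the position of the factor, factors may be exchanged. If the words consist of
  many blocks of equal length, the factor can be chosen to separate large sets of blocks. Doing
  this for finitely many context-free languages in turn leaves two blocks that are separated by
  all the chosen factors, at the price of restricting to a subfamily of the words that is smaller
  by at most a factor polynomial in the word length, of degree \<open>e\<close> depending only on the languages.
  Now let the blocks spell arbitrary elements of a box with \<open>K\<^sup>M\<close> points in \<open>\<int>\<^sup>M\<close>.
  Fixing the product of the blocks reduces the number of choices by a factor of about
  \<open>K\<^sup>M\<close> only. In the subfamily, on the other hand, an exchange of one of the two blocks must again give a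
  word of the intersection, that is, a word with trivial value; so the other blocks determine the
  two separated ones and another factor \<open>K\<^sup>M\<close> is lost. Hence \<open>K\<^sup>M\<close> is bounded by a constant
  times \<open>K\<^sup>e\<close>, which is false for \<open>M > e\<close> and large \<open>K\<close>.
\<close>

section \<open>Derivation trees of context-free grammars\<close>

text \<open>A big-step form of derivability: the derivation of \<open>yields P \<gamma> w\<close> is the forest of
  derivation trees with roots \<open>\<gamma>\<close> and yield \<open>w\<close>, so that inductions over it are inductions over
  trees.\<close>

inductive yields :: "('n, 't) production set \<Rightarrow> ('n + 't) list \<Rightarrow> 't list \<Rightarrow> bool" for P where
  Nil: "yields P [] []"
| Letter: "yields P \<gamma> w \<Longrightarrow> yields P (Inr a # \<gamma>) (a # w)"
| Production: "(A, \<alpha>) \<in> P \<Longrightarrow> yields P \<alpha> u \<Longrightarrow> yields P \<gamma> v \<Longrightarrow> yields P (Inl A # \<gamma>) (u @ v)"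

inductive_cases yields_LetterE: "yields P (Inr a # \<gamma>) w"
inductive_cases yields_ProductionE: "yields P (Inl A # \<gamma>) w"

lemma yields_append:
  assumes "yields P \<alpha> u" "yields P \<beta> v"
  shows "yields P (\<alpha> @ \<beta>) (u @ v)"
  using assms by (induction rule: yields.induct) (auto intro: yields.intros)

lemma yields_appendE:
  assumes "yields P (\<alpha> @ \<beta>) w"
  obtains u v where "w = u @ v" "yields P \<alpha> u" "yields P \<beta> v"
proof -
  have "\<exists>u v. w = u @ v \<and> yields P \<alpha> u \<and> yields P \<beta> v"
    using assms
  proof (induction \<alpha> arbitrary: w)
    case Nil
    then show ?case by (auto intro: yields.Nil)
  next
    case (Cons s \<alpha>)
    show ?case
    proof (cases s)
      case (Inl A)
      with Cons.prems obtain \<delta> x y where *: "(A, \<delta>) \<in> P" "yields P \<delta> x" "yields P (\<alpha> @ \<beta>) y" "w = x @ y"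
        by (auto elim: yields_ProductionE)
      from Cons.IH[OF *(3)] obtain u v where "y = u @ v" "yields P \<alpha> u" "yields P \<beta> v" by blast
      with * Inl show ?thesis
        by (intro exI[of _ "x @ u"] exI[of _ v]) (auto intro: yields.intros)
    next
      case (Inr a)
      with Cons.prems obtain y where *: "yields P (\<alpha> @ \<beta>) y" "w = a # y"
        by (auto elim: yields_LetterE)
      from Cons.IH[OF *(1)] obtain u v where "y = u @ v" "yields P \<alpha> u" "yields P \<beta> v" by blast
      with * Inr show ?thesis
        by (intro exI[of _ "a # u"] exI[of _ v]) (auto intro: yields.intros)
    qed
  qed
  with that show thesis by blast
qed

lemma yields_map_Inr: "yields P (map Inr w) w"
  by (induction w) (auto intro: yields.intros)

lemma yields_imp_derivation:
  assumes "yields P \<gamma> w"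
  shows "(x @ \<gamma> @ y, x @ map Inr w @ y) \<in> (derivation_step P)\<^sup>*"
  using assms
proof (induction arbitrary: x y rule: yields.induct)
  case (Letter \<gamma> w a)
  from Letter.IH[of "x @ [Inr a]" y] show ?case by simp
next
  case (Production A \<alpha> u \<gamma> v)
  have "(x @ (Inl A # \<gamma>) @ y, x @ \<alpha> @ \<gamma> @ y) \<in> derivation_step P"
    using Production.hyps(1) unfolding derivation_step_def
    by (intro CollectI exI[of _ x] exI[of _ "\<gamma> @ y"] case_prodI2 exI) auto
  also have "(x @ \<alpha> @ \<gamma> @ y, x @ map Inr u @ \<gamma> @ y) \<in> (derivation_step P)\<^sup>*"
    using Production.IH(1)[of x "\<gamma> @ y"] .
  also have "(x @ map Inr u @ \<gamma> @ y, x @ map Inr u @ map Inr v @ y) \<in> (derivation_step P)\<^sup>*"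
    using Production.IH(2)[of "x @ map Inr u" y] by simp
  finally show ?case by simp
qed simp

lemma derivation_iff_yields: "(\<gamma>, map Inr w) \<in> (derivation_step P)\<^sup>* \<longleftrightarrow> yields P \<gamma> w"
proof
  assume "(\<gamma>, map Inr w) \<in> (derivation_step P)\<^sup>*"
  then show "yields P \<gamma> w"
  proof (induction rule: converse_rtrancl_induct)
    case base
    show ?case by (rule yields_map_Inr)
  next
    case (step \<gamma> \<gamma>')
    then obtain u v B \<alpha> where *: "\<gamma> = u @ [Inl B] @ v" "\<gamma>' = u @ \<alpha> @ v" "(B, \<alpha>) \<in> P"
      by (auto simp: derivation_step_def)
    with step.IH obtain w1 w2 w3 where "w = w1 @ w2 @ w3" "yields P u w1" "yields P \<alpha> w2" "yields P v w3"
      by (metis yields_appendE)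
    with * show ?case
      by (auto intro!: yields_append yields.Production)
  qed
next
  assume "yields P \<gamma> w"
  from yields_imp_derivation[OF this, of "[]" "[]"]
  show "(\<gamma>, map Inr w) \<in> (derivation_step P)\<^sup>*" by simp
qed

lemma grammar_language_eq_yields: "grammar_language P B = {w. yields P [Inl B] w}"
  by (simp add: grammar_language_def derivation_iff_yields)

definition positions_between :: "nat set \<Rightarrow> nat \<Rightarrow> nat \<Rightarrow> nat" where
  "positions_between T s n = card (T \<inter> {s..<s + n})"

lemma positions_between_add:
  "positions_between T s (m + n) = positions_between T s m + positions_between T (s + m) n"
proof -
  have "T \<inter> {s..<s + (m + n)} = (T \<inter> {s..<s + m}) \<union> (T \<inter> {s + m..<s + m + n})"
    by auto
  then show ?thesis
    unfolding positions_between_def by (simp add: card_Un_disjoint disjoint_iff)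
qed

lemma positions_between_le: "positions_between T s n \<le> n"
proof -
  have "card (T \<inter> {s..<s + n}) \<le> card {s..<s + n}" by (rule card_mono) auto
  then show ?thesis by (simp add: positions_between_def)
qed

text \<open>Some tree of the forest carries more than \<open>h\<close> marked positions. From its root descend towards
  the child with the most marks and stop at the first subtree with at most \<open>d * h\<close> of them: its
  parent has more than \<open>d * h\<close> marks and at most \<open>d\<close> children, so the heaviest child has more than
  \<open>h\<close>. This child is not a terminal, which has at most one mark. The number \<open>s\<close> is the position at
  which \<open>w\<close> begins in the surrounding word. The surroundings of the subtree are recorded only
  through the words that may replace its yield.\<close>

lemma balanced_subtree:
  assumes "yields P \<gamma> w"
    and d: "\<And>A \<alpha>. (A, \<alpha>) \<in> P \<Longrightarrow> length \<alpha> \<le> d"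
    and h: "1 \<le> h"
    and "h * length \<gamma> < positions_between T s (length w)"
  shows "\<exists>u x v A. w = u @ x @ v \<and> yields P [Inl A] x \<and>
      (\<forall>x'. yields P [Inl A] x' \<longrightarrow> yields P \<gamma> (u @ x' @ v)) \<and>
      h < positions_between T (s + length u) (length x) \<and>
      positions_between T (s + length u) (length x) \<le> d * h"
  using assms(1,4)
proof (induction arbitrary: s rule: yields.induct)
  case Nil
  then show ?case by (simp add: positions_between_def)
next
  case (Letter \<gamma> w a)
  have "positions_between T s (length (a # w)) =
      positions_between T s 1 + positions_between T (s + 1) (length w)"
    using positions_between_add[of T s 1 "length w"] by simp
  then have "h * length \<gamma> < positions_between T (s + 1) (length w)"
    using Letter.prems positions_between_le[of T s 1] h by simp
  from Letter.IH[OF this] obtain u x v A where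
    "w = u @ x @ v" "yields P [Inl A] x" "\<forall>x'. yields P [Inl A] x' \<longrightarrow> yields P \<gamma> (u @ x' @ v)"
    "h < positions_between T (s + 1 + length u) (length x)"
    "positions_between T (s + 1 + length u) (length x) \<le> d * h"
    by blast
  then show ?case
    by (intro exI[of _ "a # u"] exI[of _ x] exI[of _ v] exI[of _ A])
      (auto intro: yields.Letter)
next
  case (Production B \<alpha> y \<gamma> z)
  have sum: "positions_between T s (length (y @ z)) =
      positions_between T s (length y) + positions_between T (s + length y) (length z)"
    using positions_between_add by simp
  consider (right) "h * length \<gamma> < positions_between T (s + length y) (length z)"
    | (here) "h < positions_between T s (length y)" "positions_between T s (length y) \<le> d * h"
    | (below) "d * h < positions_between T s (length y)"
    using sum Production.prems by fastforce
  then show ?case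
  proof cases
    case right
    from Production.IH(2)[OF this] obtain u x v A where
      "z = u @ x @ v" "yields P [Inl A] x" "\<forall>x'. yields P [Inl A] x' \<longrightarrow> yields P \<gamma> (u @ x' @ v)"
      "h < positions_between T (s + length y + length u) (length x)"
      "positions_between T (s + length y + length u) (length x) \<le> d * h"
      by blast
    moreover have "yields P (Inl B # \<gamma>) ((y @ u) @ x' @ v)"
      if "yields P \<gamma> (u @ x' @ v)" for x'
      using yields.Production[OF Production.hyps(1,2) that] by simp
    ultimately show ?thesis
      by (intro exI[of _ "y @ u"] exI[of _ x] exI[of _ v] exI[of _ A]) (auto simp: add.assoc)
  next
    case here
    have "yields P [Inl B] y"
      using yields.Production[OF Production.hyps(1,2) yields.Nil] by simp
    moreover have "yields P (Inl B # \<gamma>) (x' @ z)" if "yields P [Inl B] x'" for x'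
      using yields_append[OF that Production.hyps(3)] by simp
    ultimately show ?thesis using here
      by (intro exI[of _ "[]"] exI[of _ y] exI[of _ z] exI[of _ B]) auto
  next
    case below
    have "h * length \<alpha> \<le> d * h" using d[OF Production.hyps(1)] by simp
    with below have "h * length \<alpha> < positions_between T s (length y)" by linarith
    from Production.IH(1)[OF this] obtain u x v A where
      *: "y = u @ x @ v" "yields P [Inl A] x" "\<forall>x'. yields P [Inl A] x' \<longrightarrow> yields P \<alpha> (u @ x' @ v)"
      "h < positions_between T (s + length u) (length x)"
      "positions_between T (s + length u) (length x) \<le> d * h"
      by blast
    moreover have "yields P (Inl B # \<gamma>) (u @ x' @ v @ z)" if "yields P \<alpha> (u @ x' @ v)" for x'
      using yields.Production[OF Production.hyps(1) that Production.hyps(3)] by simp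
    ultimately show ?thesis
      by (intro exI[of _ u] exI[of _ x] exI[of _ "v @ z"] exI[of _ A]) auto
  qed
qed

section \<open>Exchanging blocks in context-free languages\<close>

text \<open>Block \<open>j\<close> of a word consists of the positions \<open>i\<close> with \<open>i div l = j\<close>.\<close>

definition agree_off_blocks :: "nat \<Rightarrow> nat set \<Rightarrow> 't list \<Rightarrow> 't list \<Rightarrow> bool" where
  "agree_off_blocks l J w w' \<longleftrightarrow>
     length w = length w' \<and> (\<forall>i<length w. i div l \<notin> J \<longrightarrow> w ! i = w' ! i)"

definition swap_block :: "nat \<Rightarrow> nat \<Rightarrow> 't list \<Rightarrow> 't list \<Rightarrow> 't list" where
  "swap_block l j w w' = map (\<lambda>i. if i div l = j then w ! i else w' ! i) [0..<length w']"

text \<open>When two words differ only in the blocks \<open>j\<close> and \<open>k\<close> and a factor contains block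
  \<open>j\<close> but avoids block \<open>k\<close>, exchanging the factors has the same effect as exchanging one
  of the two blocks.\<close>

lemma swap_block_eq_replace_factor:
  assumes lengths: "length u = length u'" "length x = length x'" "length v = length v'"
    and agree: "agree_off_blocks l {j, k} (u @ x @ v) (u' @ x' @ v')"
    and inside: "\<And>i. i div l = j \<Longrightarrow> length u \<le> i \<and> i < length u + length x"
    and outside: "\<And>i. i div l = k \<Longrightarrow> \<not> (length u \<le> i \<and> i < length u + length x)"
  shows "swap_block l j (u @ x @ v) (u' @ x' @ v') = u' @ x @ v'" (is ?A)
    and "swap_block l k (u @ x @ v) (u' @ x' @ v') = u @ x' @ v" (is ?B)
proof -
  have eq: "(u @ x @ v) ! i = (u' @ x' @ v') ! i"
    if "i < length u + length x + length v" "i div l \<noteq> j" "i div l \<noteq> k" for i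
    using agree that by (simp add: agree_off_blocks_def add.assoc)
  have 1: "(u' @ x @ v') ! i =
      (if length u \<le> i \<and> i < length u + length x then (u @ x @ v) ! i else (u' @ x' @ v') ! i)" for i
    using lengths by (auto simp: nth_append)
  have 2: "(u @ x' @ v) ! i =
      (if length u \<le> i \<and> i < length u + length x then (u' @ x' @ v') ! i else (u @ x @ v) ! i)" for i
    using lengths by (auto simp: nth_append)
  show ?A
  proof (rule nth_equalityI)
    fix i assume "i < length (swap_block l j (u @ x @ v) (u' @ x' @ v'))"
    then have i: "i < length u + length x + length v" using lengths by (simp add: swap_block_def)
    then have "swap_block l j (u @ x @ v) (u' @ x' @ v') ! i =
      (if i div l = j then (u @ x @ v) ! i else (u' @ x' @ v') ! i)"
      using lengths by (simp add: swap_block_def del: upt_Suc)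
    also have "\<dots> = (u' @ x @ v') ! i"
      unfolding 1 using eq[OF i] inside[of i] outside[of i] by (cases "i div l = k") auto
    finally show "swap_block l j (u @ x @ v) (u' @ x' @ v') ! i = (u' @ x @ v') ! i" .
  qed (use lengths in \<open>simp add: swap_block_def\<close>)
  show ?B
  proof (rule nth_equalityI)
    fix i assume "i < length (swap_block l k (u @ x @ v) (u' @ x' @ v'))"
    then have i: "i < length u + length x + length v" using lengths by (simp add: swap_block_def)
    then have "swap_block l k (u @ x @ v) (u' @ x' @ v') ! i =
      (if i div l = k then (u @ x @ v) ! i else (u' @ x' @ v') ! i)"
      using lengths by (simp add: swap_block_def del: upt_Suc)
    also have "\<dots> = (u @ x' @ v) ! i"
      unfolding 2 using eq[OF i] inside[of i] outside[of i] by (cases "i div l = j") auto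
    finally show "swap_block l k (u @ x @ v) (u' @ x' @ v') ! i = (u @ x' @ v) ! i" .
  qed (use lengths in \<open>simp add: swap_block_def\<close>)
qed

text \<open>Blocks are classified by their first positions. At each end of the interval only the block
  that straddles it is misclassified, which costs at most one block in each set.\<close>

lemma blocks_inside_and_outside_interval:
  fixes p q :: "nat set"
  assumes fin: "finite p" "finite q" and l: "1 \<le> l"
    and p: "m + 1 \<le> card {j \<in> p. s \<le> j * l \<and> j * l < s + n}"
    and q: "m + 1 \<le> card {j \<in> q. \<not> (s \<le> j * l \<and> j * l < s + n)}"
  obtains p' q' where "p' \<subseteq> p" "q' \<subseteq> q" "m \<le> card p'" "m \<le> card q'"
    "\<And>j i. j \<in> p' \<Longrightarrow> i div l = j \<Longrightarrow> s \<le> i \<and> i < s + n"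
    "\<And>j i. j \<in> q' \<Longrightarrow> i div l = j \<Longrightarrow> \<not> (s \<le> i \<and> i < s + n)"
proof -
  let ?p = "{j \<in> p. s \<le> j * l \<and> j * l < s + n} - {(s + n) div l}"
  let ?q = "{j \<in> q. \<not> (s \<le> j * l \<and> j * l < s + n)} - {s div l}"
  have start: "i div l * l \<le> i" "i < i div l * l + l" for i
    using l div_mult_mod_eq[of i l] mod_less_divisor[of l i] by linarith+
  have before: "j * l + l \<le> t" if "j * l < t" "j \<noteq> t div l" for j t
  proof -
    have "j \<le> t div l"
      using div_le_mono[of "j * l" t l] that(1) l by simp
    with that(2) have "j < t div l" by simp
    then have "(j + 1) * l \<le> t div l * l" by (intro mult_le_mono) auto
    with start(1)[of t] show ?thesis unfolding add_mult_distrib by linarith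
  qed
  show thesis
  proof (rule that[of ?p ?q])
    show "m \<le> card ?p" "m \<le> card ?q"
      using p q fin by (auto simp: card_Diff_singleton_if)
    show "s \<le> i \<and> i < s + n" if "j \<in> ?p" "i div l = j" for i j
      using that start[of i] before[of j "s + n"] by auto
    show "\<not> (s \<le> i \<and> i < s + n)" if "j \<in> ?q" "i div l = j" for i j
    proof -
      have "j * l \<le> i" "i < j * l + l" using start[of i] unfolding that(2) .
      moreover have "j * l < s \<or> s + n \<le> j * l" "j * l < s \<Longrightarrow> j * l + l \<le> s"
        using that(1) before[of j s] by auto
      ultimately show ?thesis by linarith
    qed
  qed auto
qed

lemma pigeonhole_fiber:
  assumes "finite D" "f ` R \<subseteq> D" "finite R" "R \<noteq> {}"
  obtains y where "y \<in> D" "card R \<le> card D * card {x \<in> R. f x = y}"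
proof -
  have "\<exists>y\<in>D. card R \<le> card D * card {x \<in> R. f x = y}"
  proof (rule ccontr)
    assume "\<not> ?thesis"
    then have less: "card D * card {x \<in> R. f x = y} < card R" if "y \<in> D" for y
      using that by (simp add: not_le)
    have "R = (\<Union>y\<in>D. {x \<in> R. f x = y})" using assms(2) by auto
    then have "card R \<le> (\<Sum>y\<in>D. card {x \<in> R. f x = y})"
      using card_UN_le[OF assms(1)] by metis
    then have "card D * card R \<le> (\<Sum>y\<in>D. card D * card {x \<in> R. f x = y})"
      by (metis mult_le_mono2 sum_distrib_left)
    also have "\<dots> < (\<Sum>y\<in>D. card R)"
      using less assms by (intro sum_strict_mono) auto
    finally show False by simp
  qed
  with that show thesis by blast
qed

text \<open>A family of words of length \<open>N\<close>, together with two disjoint reservoirs \<open>p\<close> and \<open>q\<close> of at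
  least \<open>m\<close> blocks each, from which a pair of separated blocks is to be chosen.\<close>

definition block_family ::
    "nat \<Rightarrow> nat set \<Rightarrow> nat set \<Rightarrow> nat \<Rightarrow> nat \<Rightarrow> 't list set \<Rightarrow> bool" where
  "block_family m p q l N R \<longleftrightarrow>
     p \<inter> q = {} \<and> finite p \<and> finite q \<and> m \<le> card p \<and> m \<le> card q \<and>
     1 \<le> l \<and> (\<forall>j\<in>p \<union> q. j * l + l \<le> N) \<and> finite R \<and> (\<forall>w\<in>R. length w = N)"

definition swaps_into :: "nat \<Rightarrow> nat \<Rightarrow> nat \<Rightarrow> 't list set \<Rightarrow> 't list set \<Rightarrow> bool" where
  "swaps_into l j k R L \<longleftrightarrow>
     (\<forall>w\<in>R. \<forall>w'\<in>R. agree_off_blocks l {j, k} w w' \<longrightarrow> swap_block l j w w' \<in> L)"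

text \<open>Mark the first positions of equally many blocks of \<open>p\<close> and of \<open>q\<close>, and choose for each word
  a balanced subtree. The nonterminal at its root and the position and length of its yield take at
  most \<open>C * (N + 1)\<^sup>2\<close> values, so a large part \<open>R'\<close> of the family agrees in them. By
  the balance condition the common interval contains many blocks of one reservoir and misses many
  blocks of the other one.\<close>

lemma context_free_swap_blocks:
  assumes "context_free (L :: 't list set)"
  shows "\<exists>C. \<forall>m'. \<exists>m. \<forall>p q l N R.
    block_family m p q l N R \<and> R \<subseteq> L \<longrightarrow>
    (\<exists>R' p' q'. R' \<subseteq> R \<and> p' \<subseteq> p \<and> q' \<subseteq> q \<and> m' \<le> card p' \<and> m' \<le> card q' \<and>
      card R \<le> C * (N + 1)^2 * card R' \<and>
      (\<forall>j\<in>p'. \<forall>k\<in>q'. swaps_into l j k R' L))"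
proof -
  obtain P :: "(nat, 't) production set" and B where P: "finite P" and L: "L = {w. yields P [Inl B] w}"
    using assms unfolding context_free_def grammar_language_eq_yields by blast
  obtain d where d: "\<And>A \<alpha>. (A, \<alpha>) \<in> P \<Longrightarrow> length \<alpha> \<le> d" and d1: "1 \<le> d"
  proof
    show "length \<alpha> \<le> Max (insert 1 ((length \<circ> snd) ` P))" if "(A, \<alpha>) \<in> P" for A \<alpha>
      using P that by (intro Max_ge) (auto intro!: image_eqI[of _ _ "(A, \<alpha>)"])
  qed (use P in auto)
  show ?thesis
  proof (rule exI[of _ "card (fst ` P)"], rule allI)
    fix m' :: nat
    \<comment> \<open>An interval with more than \<open>2 * (m' + 1)\<close> marks contains \<open>m' + 1\<close> marked blocks from one of
      the reservoirs; one of these may be cut by an end of the interval. An interval with at most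
      \<open>d * ?h\<close> marks, half of all marks, misses at least as many blocks of the other reservoir.\<close>
    let ?h = "2 * (m' + 1)"
    let ?m = "d * ?h"
    show "\<exists>m. \<forall>p q l N R.
      block_family m p q l N R \<and> R \<subseteq> L \<longrightarrow>
      (\<exists>R' p' q'. R' \<subseteq> R \<and> p' \<subseteq> p \<and> q' \<subseteq> q \<and> m' \<le> card p' \<and> m' \<le> card q' \<and>
        card R \<le> card (fst ` P) * (N + 1)^2 * card R' \<and>
        (\<forall>j\<in>p'. \<forall>k\<in>q'. swaps_into l j k R' L))"
    proof (intro exI[of _ ?m] allI impI, elim conjE)
      fix p q :: "nat set" and l N :: nat and R :: "'t list set"
      assume "block_family ?m p q l N R" and R: "R \<subseteq> L"
      then have disj: "p \<inter> q = {}" and fin: "finite p" "finite q" "finite R"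
        and card: "?m \<le> card p" "?m \<le> card q" and l: "1 \<le> l"
        and fits: "\<forall>j\<in>p \<union> q. j * l + l \<le> N" and N: "\<forall>w\<in>R. length w = N"
        by (auto simp: block_family_def)
      have "m' \<le> ?m" using d1 mult_le_mono[of 1 d m' ?h] by simp
      obtain p0 q0 where p0: "p0 \<subseteq> p" "card p0 = ?m" "finite p0" and q0: "q0 \<subseteq> q" "card q0 = ?m" "finite q0"
        using card by (metis obtain_subset_with_card_n)
      have disj0: "p0 \<inter> q0 = {}" using disj p0 q0 by blast
      show "\<exists>R' p' q'. R' \<subseteq> R \<and> p' \<subseteq> p \<and> q' \<subseteq> q \<and> m' \<le> card p' \<and> m' \<le> card q' \<and>
        card R \<le> card (fst ` P) * (N + 1)^2 * card R' \<and>
        (\<forall>j\<in>p'. \<forall>k\<in>q'. swaps_into l j k R' L)"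
      proof (cases "R = {}")
        case True
        then show ?thesis using p0 q0 \<open>m' \<le> ?m\<close>
          by (intro exI[of _ R] exI[of _ p0] exI[of _ q0]) (simp add: swaps_into_def)
      next
        case False
        define T where "T = (\<lambda>j. j * l) ` (p0 \<union> q0)"
        have inj: "inj (\<lambda>j. j * l)" using l by (auto simp: inj_on_def)
        have T: "positions_between T s n =
            card {j \<in> p0. s \<le> j * l \<and> j * l < s + n} + card {j \<in> q0. s \<le> j * l \<and> j * l < s + n}" for s n
        proof -
          have "T \<inter> {s..<s + n} = (\<lambda>j. j * l) `
              ({j \<in> p0. s \<le> j * l \<and> j * l < s + n} \<union> {j \<in> q0. s \<le> j * l \<and> j * l < s + n})"
            by (auto simp: T_def)
          then have "positions_between T s n =
              card ({j \<in> p0. s \<le> j * l \<and> j * l < s + n} \<union> {j \<in> q0. s \<le> j * l \<and> j * l < s + n})"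
            unfolding positions_between_def by (simp add: card_image[OF inj_on_subset[OF inj]])
          also have "\<dots> = card {j \<in> p0. s \<le> j * l \<and> j * l < s + n} + card {j \<in> q0. s \<le> j * l \<and> j * l < s + n}"
            using disj0 p0 q0 by (intro card_Un_disjoint) auto
          finally show ?thesis .
        qed
        have small: "j * l < N" if "j \<in> p0 \<union> q0" for j
          proof -
          have "j * l + l \<le> N" using fits that p0(1) q0(1) by blast
          with l show ?thesis by linarith
        qed
        have "{j \<in> p0. 0 \<le> j * l \<and> j * l < 0 + N} = p0" "{j \<in> q0. 0 \<le> j * l \<and> j * l < 0 + N} = q0"
          using small by auto
        then have total: "positions_between T 0 N = 2 * ?m"
          using T[of 0 N] p0(2) q0(2) by simp
        have "?h * length [Inl B :: nat + 't] < positions_between T 0 N"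
          using total d1 by (cases d) auto
        then have "\<exists>u x v A. w = u @ x @ v \<and> yields P [Inl A] x \<and>
            (\<forall>x'. yields P [Inl A] x' \<longrightarrow> yields P [Inl B] (u @ x' @ v)) \<and>
            ?h < positions_between T (length u) (length x) \<and>
            positions_between T (length u) (length x) \<le> ?m" if "w \<in> R" for w
          using balanced_subtree[of P "[Inl B]" w d ?h T 0] d R N L that by auto
        then obtain u x v A where dec: "\<And>w. w \<in> R \<Longrightarrow> w = u w @ x w @ v w"
            and A: "\<And>w. w \<in> R \<Longrightarrow> yields P [Inl (A w)] (x w)"
            and ctx: "\<And>w x'. w \<in> R \<Longrightarrow> yields P [Inl (A w)] x' \<Longrightarrow> yields P [Inl B] (u w @ x' @ v w)"
            and bal: "\<And>w. w \<in> R \<Longrightarrow> ?h < positions_between T (length (u w)) (length (x w))"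
              "\<And>w. w \<in> R \<Longrightarrow> positions_between T (length (u w)) (length (x w)) \<le> ?m"
          by metis
        have len: "length (u w) + length (x w) + length (v w) = N" if "w \<in> R" for w
          using dec[OF that] N that by (metis length_append add.assoc)
        define \<sigma> where "\<sigma> w = (length (u w), length (x w), A w)" for w
        define D where "D = {..N} \<times> {..N} \<times> fst ` P"
        have "A w \<in> fst ` P" if "w \<in> R" for w
        proof -
          obtain \<alpha> where "(A w, \<alpha>) \<in> P" using A[OF \<open>w \<in> R\<close>] by (rule yields_ProductionE)
          then show ?thesis by force
        qed
        then have "\<sigma> ` R \<subseteq> D" using len by (fastforce simp: \<sigma>_def D_def)
        moreover have "finite D" using P by (simp add: D_def)
        ultimately obtain y where y: "card R \<le> card D * card {w \<in> R. \<sigma> w = y}"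
          using pigeonhole_fiber[of D \<sigma> R] fin(3) False by blast
        define R' where "R' = {w \<in> R. \<sigma> w = y}"
        have "card D = card (fst ` P) * (N + 1)^2"
          by (simp add: D_def card_cartesian_product power2_eq_square algebra_simps)
        with y have cardR': "card R \<le> card (fst ` P) * (N + 1)^2 * card R'" by (simp add: R'_def)
        have "R' \<noteq> {}" using cardR' False fin(3) by auto
        obtain s n E where ysn: "y = (s, n, E)" by (cases y)
        have R'D: "w \<in> R" "length (u w) = s" "length (x w) = n" "A w = E" if "w \<in> R'" for w
          using that ysn by (auto simp: R'_def \<sigma>_def)
        have glue: "u w @ x w' @ v w \<in> L" if "w \<in> R'" "w' \<in> R'" for w w'
          unfolding L using ctx[of w "x w'"] A[of w'] R'D[OF that(1)] R'D[OF that(2)] by simp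
        have lens: "length (u w) = length (u w')" "length (x w) = length (x w')" "length (v w) = length (v w')"
          if "w \<in> R'" "w' \<in> R'" for w w'
          using R'D[OF that(1)] R'D[OF that(2)] len[of w] len[of w'] by auto
        have bal': "?h < positions_between T s n" "positions_between T s n \<le> ?m"
          using \<open>R' \<noteq> {}\<close> bal R'D by fastforce+
        let ?in = "\<lambda>r. {j \<in> r. s \<le> j * l \<and> j * l < s + n}"
        let ?out = "\<lambda>r. {j \<in> r. \<not> (s \<le> j * l \<and> j * l < s + n)}"
        have compl: "card (?in r) + card (?out r) = card r" if "finite r" for r
          using that by (subst card_Un_disjoint[symmetric]) (auto intro!: arg_cong[of _ _ card])
        have "card (?in p0) \<le> card (?out q0)" "card (?in q0) \<le> card (?out p0)"
          using bal'(2) T[of s n] compl[OF p0(3)] compl[OF q0(3)] p0(2) q0(2) by linarith+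
        moreover have "m' + 1 \<le> card (?in p0) \<or> m' + 1 \<le> card (?in q0)"
          using bal'(1) T[of s n] by arith
        ultimately consider "m' + 1 \<le> card (?in p0)" "m' + 1 \<le> card (?out q0)"
          | "m' + 1 \<le> card (?in q0)" "m' + 1 \<le> card (?out p0)"
          using le_trans by blast
        then show ?thesis
        proof cases
          case 1
          then obtain p' q' where sub: "p' \<subseteq> p0" "q' \<subseteq> q0" "m' \<le> card p'" "m' \<le> card q'"
            and ins: "\<And>j i. j \<in> p' \<Longrightarrow> i div l = j \<Longrightarrow> s \<le> i \<and> i < s + n"
            and out: "\<And>j i. j \<in> q' \<Longrightarrow> i div l = j \<Longrightarrow> \<not> (s \<le> i \<and> i < s + n)"
            using blocks_inside_and_outside_interval[OF p0(3) q0(3) l] by blast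
          have "swap_block l j w w' \<in> L"
            if w: "w \<in> R'" "w' \<in> R'" and jk: "j \<in> p'" "k \<in> q'" and agree: "agree_off_blocks l {j, k} w w'"
            for w w' j k
          proof -
            have e: "w = u w @ x w @ v w" "w' = u w' @ x w' @ v w'"
              using dec R'D w by blast+
            have "swap_block l j (u w @ x w @ v w) (u w' @ x w' @ v w') = u w' @ x w @ v w'"
              by (rule swap_block_eq_replace_factor(1)[where k = k])
                (use lens[OF w] ins[OF jk(1)] out[OF jk(2)] R'D[OF w(1)] agree e in auto)
            with e glue[OF w(2,1)] show ?thesis by simp
          qed
          then show ?thesis using sub p0(1) q0(1) cardR'
            by (intro exI[of _ R'] exI[of _ p'] exI[of _ q']) (auto simp: R'_def swaps_into_def)
        next
          case 2
          then obtain q' p' where sub: "q' \<subseteq> q0" "p' \<subseteq> p0" "m' \<le> card q'" "m' \<le> card p'"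
            and ins: "\<And>j i. j \<in> q' \<Longrightarrow> i div l = j \<Longrightarrow> s \<le> i \<and> i < s + n"
            and out: "\<And>j i. j \<in> p' \<Longrightarrow> i div l = j \<Longrightarrow> \<not> (s \<le> i \<and> i < s + n)"
            using blocks_inside_and_outside_interval[OF q0(3) p0(3) l] by blast
          have "swap_block l j w w' \<in> L"
            if w: "w \<in> R'" "w' \<in> R'" and jk: "j \<in> p'" "k \<in> q'" and agree: "agree_off_blocks l {j, k} w w'"
            for w w' j k
          proof -
            have e: "w = u w @ x w @ v w" "w' = u w' @ x w' @ v w'"
              using dec R'D w by blast+
            have "swap_block l j (u w @ x w @ v w) (u w' @ x w' @ v w') = u w @ x w' @ v w"
              by (rule swap_block_eq_replace_factor(2)[where j = k])
                (use lens[OF w] ins[OF jk(2)] out[OF jk(1)] R'D[OF w(1)] agree e in \<open>auto simp: insert_commute\<close>)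
            with e glue[OF w] show ?thesis by simp
          qed
          then show ?thesis using sub p0(1) q0(1) cardR'
            by (intro exI[of _ R'] exI[of _ p'] exI[of _ q']) (auto simp: R'_def swaps_into_def)
        qed
      qed
    qed
  qed
qed

text \<open>The languages are treated one after the other, each within the reservoirs and the family
  left over by the previous one; the losses multiply. Since membership in \<open>swaps_into\<close> passes to
  smaller families, all languages allow the swap in the end.\<close>

lemma poly_context_free_swap_blocks:
  assumes "finite \<L>" "\<forall>L\<in>\<L>. context_free (L :: 't list set)"
  shows "\<exists>C e m. \<forall>p q l N R.
    block_family m p q l N R \<and> (\<forall>L\<in>\<L>. R \<subseteq> L) \<longrightarrow>
    (\<exists>R' j k. R' \<subseteq> R \<and> j \<in> p \<and> k \<in> q \<and> card R \<le> C * (N + 1)^e * card R' \<and>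
      (\<forall>L\<in>\<L>. swaps_into l j k R' L))"
  using assms
proof (induction \<L>)
  case empty
  show ?case
  proof (rule exI[of _ 1], rule exI[of _ 0], rule exI[of _ 1], intro allI impI, elim conjE)
    fix p q :: "nat set" and l N :: nat and R :: "'t list set"
    assume "block_family 1 p q l N R"
    then have "p \<noteq> {}" "q \<noteq> {}" by (auto simp: block_family_def)
    then obtain j k where "j \<in> p" "k \<in> q" by blast
    then show "\<exists>R' j k. R' \<subseteq> R \<and> j \<in> p \<and> k \<in> q \<and> card R \<le> 1 * (N + 1)^0 * card R' \<and>
      (\<forall>L\<in>{}. swaps_into l j k R' L)"
      by (intro exI[of _ R] exI[of _ j] exI[of _ k]) simp
  qed
next
  case (insert L \<L>)
  have "\<forall>L\<in>\<L>. context_free L" using insert.prems by simp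
  from insert.IH[OF this] obtain C e m' where IH: "\<forall>p q l N R.
    block_family m' p q l N R \<and> (\<forall>L\<in>\<L>. R \<subseteq> L) \<longrightarrow>
    (\<exists>R' j k. R' \<subseteq> R \<and> j \<in> p \<and> k \<in> q \<and> card R \<le> C * (N + 1)^e * card R' \<and>
      (\<forall>L\<in>\<L>. swaps_into l j k R' L))"
    by (elim exE) (rule that)
  have "context_free L" using insert.prems by simp
  from context_free_swap_blocks[OF this] obtain C' m where L: "\<forall>p q l N R.
    block_family m p q l N R \<and> R \<subseteq> L \<longrightarrow>
    (\<exists>R' p' q'. R' \<subseteq> R \<and> p' \<subseteq> p \<and> q' \<subseteq> q \<and> m' \<le> card p' \<and> m' \<le> card q' \<and>
      card R \<le> C' * (N + 1)^2 * card R' \<and>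
      (\<forall>j\<in>p'. \<forall>k\<in>q'. swaps_into l j k R' L))"
    by (elim exE allE[of _ m']) (rule that)
  show ?case
  proof (rule exI[of _ "C' * C"], rule exI[of _ "2 + e"], rule exI[of _ m],
      intro allI impI, elim conjE)
    fix p q :: "nat set" and l N :: nat and R :: "'t list set"
    assume *: "block_family m p q l N R" "\<forall>L\<in>insert L \<L>. R \<subseteq> L"
    then obtain R1 p1 q1 where 1: "R1 \<subseteq> R" "p1 \<subseteq> p" "q1 \<subseteq> q" "m' \<le> card p1" "m' \<le> card q1"
      "card R \<le> C' * (N + 1)^2 * card R1"
      "\<forall>j\<in>p1. \<forall>k\<in>q1. swaps_into l j k R1 L"
      using L[THEN spec, THEN spec, THEN spec, THEN spec, THEN spec, THEN mp, of p q l N R] by auto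
    have "block_family m' p1 q1 l N R1"
      using *(1) 1(1-5) by (auto simp: block_family_def intro: finite_subset)
    moreover have "\<forall>L\<in>\<L>. R1 \<subseteq> L" using *(2) 1(1) by blast
    ultimately have "\<exists>R' j k. R' \<subseteq> R1 \<and> j \<in> p1 \<and> k \<in> q1 \<and> card R1 \<le> C * (N + 1)^e * card R' \<and>
      (\<forall>L\<in>\<L>. swaps_into l j k R' L)"
      by (intro IH[THEN spec, THEN spec, THEN spec, THEN spec, THEN spec, THEN mp] conjI)
    then obtain R2 j k where 2: "R2 \<subseteq> R1" "j \<in> p1" "k \<in> q1" "card R1 \<le> C * (N + 1)^e * card R2"
      "\<forall>L\<in>\<L>. swaps_into l j k R2 L"
      by blast
    have "card R \<le> C' * (N + 1)^2 * (C * (N + 1)^e * card R2)"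
      using 1(6) 2(4) by (meson mult_le_mono2 order_trans)
    then have "card R \<le> C' * C * (N + 1)^(2 + e) * card R2" by (simp only: power_add mult_ac)
    moreover have "swaps_into l j k R2 L"
      using 1(7) 2(1-3) unfolding swaps_into_def by blast
    ultimately show "\<exists>R' j k. R' \<subseteq> R \<and> j \<in> p \<and> k \<in> q \<and> card R \<le> C' * C * (N + 1)^(2 + e) * card R' \<and>
      (\<forall>L\<in>insert L \<L>. swaps_into l j k R' L)"
      using 1(1-3) 2(1-3,5) by (intro exI[of _ R2] exI[of _ j] exI[of _ k]) auto
  qed
qed

section \<open>Poly-context-free groups have no free abelian subgroup of infinite rank\<close>

lemma length_concat_equal_lengths:
  "(\<And>j. j < n \<Longrightarrow> length (f j) = l) \<Longrightarrow> length (concat (map f [0..<n])) = n * l"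
  by (induction n) auto

lemma nth_concat_equal_lengths:
  assumes "\<And>j. j < n \<Longrightarrow> length (f j) = l" "i < n * l"
  shows "concat (map f [0..<n]) ! i = f (i div l) ! (i mod l)"
  using assms
proof (induction n)
  case (Suc n)
  have l: "length (concat (map f [0..<n])) = n * l"
    using Suc.prems(1) by (intro length_concat_equal_lengths) simp
  show ?case
  proof (cases "i < n * l")
    case True
    with Suc l show ?thesis by (simp add: nth_append)
  next
    case False
    then have "i div l = n" using Suc.prems(2) by (intro div_nat_eqI) (auto simp: mult.commute)
    moreover from this have "i mod l = i - n * l" by (metis minus_div_mult_eq_mod)
    ultimately show ?thesis using False l by (simp add: nth_append)
  qed
qed simp

lemma (in monoid) word_value_closed:
  "w \<in> lists (carrier G) \<Longrightarrow> word_value G w \<in> carrier G"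
  by (induction w) (auto simp: word_value_def)

lemma (in monoid) word_value_append:
  assumes "u \<in> lists (carrier G)" "v \<in> lists (carrier G)"
  shows "word_value G (u @ v) = word_value G u \<otimes> word_value G v"
  using assms(1)
proof (induction u)
  case Nil
  then show ?case using word_value_closed[OF assms(2)] by (simp add: word_value_def)
next
  case (Cons x u)
  then show ?case
    using word_value_closed[OF assms(2)] word_value_closed[of u] assms(2)
    by (simp add: word_value_def m_assoc)
qed

definition inverse_word :: "('a, 'b) monoid_scheme \<Rightarrow> 'a list \<Rightarrow> 'a list" where
  "inverse_word G w = rev (map (\<lambda>x. inv\<^bsub>G\<^esub> x) w)"

lemma (in group) word_value_inverse_word:
  assumes "w \<in> lists (carrier G)"
  shows "word_value G (inverse_word G w) = inv (word_value G w)"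
  using assms
proof (induction w)
  case Nil
  show ?case by (simp add: inverse_word_def word_value_def)
next
  case (Cons x w)
  then have "word_value G (inverse_word G (x # w)) = word_value G (inverse_word G w) \<otimes> word_value G [inv x]"
    unfolding inverse_word_def
    by (simp add: word_value_append in_lists_conv_set image_subset_iff subset_iff)
  also have "\<dots> = inv (word_value G w) \<otimes> inv x"
    using Cons by (simp add: word_value_def)
  also have "\<dots> = inv (word_value G (x # w))"
    using Cons.hyps word_value_closed[of w] by (simp add: word_value_def inv_mult_group)
  finally show ?case .
qed

lemma (in group) word_over_symmetric_generating_set:
  assumes A: "symmetric_generating_set G A" and g: "g \<in> carrier G"
  obtains w where "w \<in> lists A" "word_value G w = g"
proof -
  have sub: "A \<subseteq> carrier G" and sym: "\<And>x. x \<in> A \<Longrightarrow> inv x \<in> A"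
    using A by (auto simp: symmetric_generating_set_def)
  have "g \<in> generate G A" using A g by (simp add: symmetric_generating_set_def)
  then have "\<exists>w\<in>lists A. word_value G w = g"
  proof (induction rule: generate.induct)
    case one
    show ?case by (intro bexI[of _ "[]"]) (auto simp: word_value_def)
  next
    case (incl x)
    then show ?case using sub by (intro bexI[of _ "[x]"]) (auto simp: word_value_def)
  next
    case (inv x)
    then show ?case using sub sym by (intro bexI[of _ "[inv x]"]) (auto simp: word_value_def)
  next
    case (eng x y)
    then obtain u v where "u \<in> lists A" "v \<in> lists A" "word_value G u = x" "word_value G v = y" by blast
    moreover from this have "u \<in> lists (carrier G)" "v \<in> lists (carrier G)" using sub by auto
    ultimately show ?case by (intro bexI[of _ "u @ v"]) (auto simp: word_value_append)
  qed
  with that show thesis by blast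
qed

text \<open>The words \<open>U i\<close> spell a basis of a free abelian subgroup. Vectors with \<open>M\<close> coordinates in
  \<open>{..<K}\<close> are coded as blocks, and \<open>n\<close> blocks are put in a row.\<close>

locale free_abelian_words = group G for G (structure) +
  fixes A :: "'a set" and h :: "(nat \<Rightarrow>\<^sub>0 int) \<Rightarrow> 'a" and U :: "nat \<Rightarrow> 'a list"
    and M K n :: nat
  assumes generators_closed: "A \<subseteq> carrier G"
    and generators_inv_closed: "x \<in> A \<Longrightarrow> inv x \<in> A"
    and embedding: "h \<in> hom (free_Abelian_group UNIV) G" "inj h"
    and basis_words: "U i \<in> lists A" "word_value G (U i) = h (frag_of i)"
begin

definition spells :: "'a list \<Rightarrow> (nat \<Rightarrow>\<^sub>0 int) \<Rightarrow> bool" where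
  "spells w v \<longleftrightarrow> w \<in> lists A \<and> word_value G w = h v"

lemma h_add: "h (v + v') = h v \<otimes> h v'"
  using hom_mult[OF embedding(1), of v v'] by simp

lemma h_closed: "h v \<in> carrier G"
  using hom_carrier[OF embedding(1)] by auto

lemma h_zero: "h 0 = \<one>"
  using h_add[of 0 0] h_closed[of 0] by simp

lemma h_minus: "h (- v) = inv (h v)"
  using h_add[of "- v" v] h_closed[of v] h_closed[of "- v"]
  by (simp add: h_zero inv_equality)

lemma spells_lists: "spells w v \<Longrightarrow> w \<in> lists (carrier G)"
  using generators_closed by (auto simp: spells_def)

lemma spells_unique: "spells w v \<Longrightarrow> spells w v' \<Longrightarrow> v = v'"
  using embedding(2) by (auto simp: spells_def inj_def)

lemma spells_Nil: "spells [] 0"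
  by (simp add: spells_def word_value_def h_zero)

lemma spells_append: "spells w v \<Longrightarrow> spells w' v' \<Longrightarrow> spells (w @ w') (v + v')"
  using word_value_append[OF spells_lists spells_lists, of w v w' v'] by (auto simp: spells_def h_add)

lemma spells_inverse_word: "spells w v \<Longrightarrow> spells (inverse_word G w) (- v)"
  using word_value_inverse_word[OF spells_lists, of w v] generators_inv_closed
  by (auto simp: spells_def h_minus inverse_word_def in_lists_conv_set)

lemma spells_U: "spells (U i) (frag_of i)"
  using basis_words by (simp add: spells_def)

lemma spells_concat:
  "(\<And>i. i < m \<Longrightarrow> spells (f i) (g i)) \<Longrightarrow> spells (concat (map f [0..<m])) (\<Sum>i<m. g i)"
  by (induction m) (auto intro: spells_Nil spells_append)

lemma spells_replicate:
  assumes "spells w v"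
  shows "spells (concat (replicate m w)) (frag_cmul (int m) v)"
proof -
  have "spells (concat (map (\<lambda>_. w) [0..<m])) (\<Sum>i<m. v)"
    using assms by (intro spells_concat)
  moreover have "(\<Sum>i<m. v) = frag_cmul (int m) v"
    by (induction m) (simp_all add: frag_cmul_distrib del: sum_constant)
  ultimately show ?thesis by (simp add: map_replicate_const)
qed

lemma U_nonempty: "U i \<noteq> []"
  using spells_unique[OF spells_U[of i]] spells_Nil by (metis frag_of_nonzero)

text \<open>The inverse words pad the block to a length that does not depend on \<open>x\<close>; the exponent of the
  \<open>i\<close>-th basis element becomes \<open>2 * x i - K\<close>.\<close>

definition block :: "(nat \<Rightarrow> nat) \<Rightarrow> 'a list" where
  "block x = concat (map (\<lambda>i. concat (replicate (x i) (U i)) @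
     concat (replicate (K - x i) (inverse_word G (U i)))) [0..<M])"

definition block_length :: nat where
  "block_length = K * (\<Sum>i<M. length (U i))"

lemma length_block:
  assumes "\<And>i. i < M \<Longrightarrow> x i \<le> K"
  shows "length (block x) = block_length"
proof -
  have "length (block x) = (\<Sum>i<M. x i * length (U i) + (K - x i) * length (U i))"
    by (simp add: block_def length_concat comp_def sum_list_replicate inverse_word_def
        interv_sum_list_conv_sum_set_nat atLeast0LessThan)
  also have "\<dots> = (\<Sum>i<M. K * length (U i))"
    using assms by (intro sum.cong) (auto simp flip: add_mult_distrib)
  finally show ?thesis by (simp add: block_length_def sum_distrib_left)
qed

definition exponent_vector :: "nat \<Rightarrow> (nat \<Rightarrow> nat) \<Rightarrow> nat \<Rightarrow>\<^sub>0 int" where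
  "exponent_vector m x = (\<Sum>i<M. frag_cmul (2 * int (x i) - int (m * K)) (frag_of i))"

lemma exponent_vector_add:
  "exponent_vector m x + exponent_vector m' x' = exponent_vector (m + m') (\<lambda>i. x i + x' i)"
  unfolding exponent_vector_def
  by (simp add: frag_cmul_distrib algebra_simps flip: sum.distrib frag_cmul_distrib)

lemma exponent_vector_eqD:
  assumes "exponent_vector m x = exponent_vector m x'" "i < M"
  shows "x i = x' i"
proof -
  have "poly_mapping.lookup (exponent_vector m y) i = 2 * int (y i) - int (m * K)" for y
  proof -
    have "poly_mapping.lookup (exponent_vector m y) i =
        (\<Sum>i'<M. if i' = i then 2 * int (y i') - int (m * K) else 0)"
      unfolding exponent_vector_def lookup_sum by (intro sum.cong) auto
    also have "\<dots> = 2 * int (y i) - int (m * K)" using assms(2) by simp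
    finally show ?thesis .
  qed
  from this[of x] this[of x'] show ?thesis using assms(1) by simp
qed

lemma spells_block:
  assumes "\<And>i. i < M \<Longrightarrow> x i \<le> K"
  shows "spells (block x) (exponent_vector 1 x)"
  unfolding block_def exponent_vector_def
proof (rule spells_concat)
  fix i assume "i < M"
  have "spells (concat (replicate (x i) (U i)) @ concat (replicate (K - x i) (inverse_word G (U i))))
      (frag_cmul (int (x i)) (frag_of i) + frag_cmul (int (K - x i)) (- frag_of i))"
    by (intro spells_append spells_replicate spells_inverse_word spells_U)
  moreover have "frag_cmul (int (x i)) (frag_of i) + frag_cmul (int (K - x i)) (- frag_of i)
      = frag_cmul (2 * int (x i) - int (1 * K)) (frag_of i)"
    using assms[OF \<open>i < M\<close>]
    by (simp add: of_nat_diff poly_mapping_eq_iff fun_eq_iff lookup_add algebra_simps)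
  ultimately show "spells (concat (replicate (x i) (U i)) @ concat (replicate (K - x i) (inverse_word G (U i))))
      (frag_cmul (2 * int (x i) - int (1 * K)) (frag_of i))"
    by simp
qed

definition exponents :: "(nat \<Rightarrow> nat) set" where
  "exponents = {..<M} \<rightarrow>\<^sub>E {..<K}"

definition exponent_lists :: "(nat \<Rightarrow> nat \<Rightarrow> nat) set" where
  "exponent_lists = {..<n} \<rightarrow>\<^sub>E exponents"

definition total :: "(nat \<Rightarrow> nat \<Rightarrow> nat) \<Rightarrow> nat \<Rightarrow> nat" where
  "total X = (\<lambda>i\<in>{..<M}. \<Sum>j<n. X j i)"

definition blocks :: "(nat \<Rightarrow> nat \<Rightarrow> nat) \<Rightarrow> 'a list" where
  "blocks X = concat (map (\<lambda>j. block (X j)) [0..<n])"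

text \<open>The inverse of a reference row \<open>X0\<close> is appended, so that the word is trivial in the group
  exactly when the rows \<open>X\<close> and \<open>X0\<close> have the same sum.\<close>

definition balanced_word :: "(nat \<Rightarrow> nat \<Rightarrow> nat) \<Rightarrow> (nat \<Rightarrow> nat \<Rightarrow> nat) \<Rightarrow> 'a list" where
  "balanced_word X0 X = blocks X @ inverse_word G (blocks X0)"

lemma exponent_lists_less:
  "X \<in> exponent_lists \<Longrightarrow> j < n \<Longrightarrow> i < M \<Longrightarrow> X j i < K"
  by (fastforce simp: exponent_lists_def exponents_def PiE_iff)

lemma length_block_exponent_lists:
  "X \<in> exponent_lists \<Longrightarrow> j < n \<Longrightarrow> length (block (X j)) = block_length"
  by (intro length_block) (meson exponent_lists_less less_imp_le)

lemma spells_block_exponent_lists: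
  "X \<in> exponent_lists \<Longrightarrow> j < n \<Longrightarrow> spells (block (X j)) (exponent_vector 1 (X j))"
  by (intro spells_block) (meson exponent_lists_less less_imp_le)

lemma length_blocks: "X \<in> exponent_lists \<Longrightarrow> length (blocks X) = n * block_length"
  unfolding blocks_def by (intro length_concat_equal_lengths length_block_exponent_lists)

lemma length_balanced_word:
  "X \<in> exponent_lists \<Longrightarrow> X0 \<in> exponent_lists \<Longrightarrow>
    length (balanced_word X0 X) = 2 * n * block_length"
  by (simp add: balanced_word_def length_blocks inverse_word_def)

lemma nth_balanced_word:
  assumes "X \<in> exponent_lists" "i < n * block_length"
  shows "balanced_word X0 X ! i = block (X (i div block_length)) ! (i mod block_length)"
  using assms length_blocks[OF assms(1)]
    nth_concat_equal_lengths[of n "\<lambda>j. block (X j)", OF length_block_exponent_lists[OF assms(1)] assms(2)]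
  by (simp add: balanced_word_def nth_append blocks_def)

lemma spells_blocks:
  assumes "X \<in> exponent_lists"
  shows "spells (blocks X) (exponent_vector n (total X))"
proof -
  have "spells (blocks X) (\<Sum>j<n. exponent_vector 1 (X j))"
    unfolding blocks_def by (intro spells_concat spells_block_exponent_lists assms)
  also have "(\<Sum>j<m. exponent_vector 1 (X j)) = exponent_vector m (\<lambda>i. \<Sum>j<m. X j i)" for m
  proof (induction m)
    case 0
    show ?case by (simp add: exponent_vector_def)
  next
    case (Suc m)
    then show ?case by (simp add: exponent_vector_add)
  qed
  also have "exponent_vector n (\<lambda>i. \<Sum>j<n. X j i) = exponent_vector n (total X)"
    unfolding exponent_vector_def by (intro sum.cong) (auto simp: total_def)
  finally show ?thesis .
qed

lemma balanced_word_in_word_problem_iff: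
  assumes "X \<in> exponent_lists" "X0 \<in> exponent_lists"
  shows "balanced_word X0 X \<in> word_problem G A \<longleftrightarrow> total X = total X0"
proof -
  have sp: "spells (balanced_word X0 X) (exponent_vector n (total X) + - exponent_vector n (total X0))"
    unfolding balanced_word_def
    by (intro spells_append spells_inverse_word spells_blocks assms)
  have "balanced_word X0 X \<in> word_problem G A \<longleftrightarrow> spells (balanced_word X0 X) 0"
    by (simp add: word_problem_def spells_def h_zero)
  also have "\<dots> \<longleftrightarrow> exponent_vector n (total X) + - exponent_vector n (total X0) = 0"
    using sp spells_unique by metis
  also have "\<dots> \<longleftrightarrow> exponent_vector n (total X) = exponent_vector n (total X0)"
    by (simp only: add_uminus_conv_diff right_minus_eq)
  also have "\<dots> \<longleftrightarrow> total X = total X0"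
  proof
    assume "exponent_vector n (total X) = exponent_vector n (total X0)"
    then have "total X i = total X0 i" if "i < M" for i
      using that by (rule exponent_vector_eqD)
    moreover have "total Y i = undefined" if "\<not> i < M" for i Y
      using that by (simp add: total_def)
    ultimately show "total X = total X0" by (metis ext)
  qed simp
  finally show ?thesis .
qed

lemma inj_on_balanced_word: "inj_on (balanced_word X0) exponent_lists"
proof (rule inj_onI)
  fix X X' assume X: "X \<in> exponent_lists" "X' \<in> exponent_lists" "balanced_word X0 X = balanced_word X0 X'"
  have "X j i = X' j i" if "j < n" "i < M" for i j
  proof -
    have "block (X j) = block (X' j)"
    proof (rule nth_equalityI)
      show "block (X j) ! r = block (X' j) ! r" if "r < length (block (X j))" for r
      proof -
        have r: "r < block_length" using that X(1) \<open>j < n\<close> by (simp add: length_block_exponent_lists)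
        have "(j + 1) * block_length \<le> n * block_length" using \<open>j < n\<close> by (intro mult_le_mono1) simp
        with r have "j * block_length + r < n * block_length" by simp
        from nth_balanced_word[OF X(1) this, of X0] nth_balanced_word[OF X(2) this, of X0] X(3) r
        show ?thesis by simp
      qed
    qed (use X that in \<open>simp add: length_block_exponent_lists\<close>)
    moreover have "spells (block (X j)) (exponent_vector 1 (X j))" "spells (block (X' j)) (exponent_vector 1 (X' j))"
      using X that(1) by (simp_all only: spells_block_exponent_lists)
    ultimately have "exponent_vector 1 (X j) = exponent_vector 1 (X' j)"
      using spells_unique by metis
    with that(2) show ?thesis by (rule exponent_vector_eqD[rotated])
  qed
  with X show "X = X'"
    by (intro PiE_ext[of X "{..<n}" "\<lambda>_. exponents" X'])
      (auto simp: exponent_lists_def exponents_def intro!: PiE_ext[of _ "{..<M}" "\<lambda>_. {..<K}"])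
qed

lemma agree_off_blocks_balanced_word:
  assumes X: "X \<in> exponent_lists" "X' \<in> exponent_lists" "X0 \<in> exponent_lists"
    and "\<And>j. j < n \<Longrightarrow> j \<notin> J \<Longrightarrow> X j = X' j"
  shows "agree_off_blocks block_length J (balanced_word X0 X) (balanced_word X0 X')"
  unfolding agree_off_blocks_def
proof (intro conjI allI impI)
  fix i assume "i < length (balanced_word X0 X)" "i div block_length \<notin> J"
  then show "balanced_word X0 X ! i = balanced_word X0 X' ! i"
  proof (cases "i < n * block_length")
    case True
    then have "i div block_length < n" by (simp add: less_mult_imp_div_less)
    then show ?thesis using True assms \<open>i div block_length \<notin> J\<close> by (simp add: nth_balanced_word)
  next
    case False
    then show ?thesis using X by (simp add: balanced_word_def nth_append length_blocks)
  qed
qed (simp add: X length_balanced_word)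

lemma swap_block_balanced_word:
  assumes X: "X \<in> exponent_lists" "X' \<in> exponent_lists" "X0 \<in> exponent_lists" and j: "j < n"
  shows "swap_block block_length j (balanced_word X0 X) (balanced_word X0 X') =
    balanced_word X0 (X'(j := X j))"
proof (rule nth_equalityI)
  have X'': "X'(j := X j) \<in> exponent_lists"
    using X j by (auto simp: exponent_lists_def PiE_iff extensional_def)
  show "length (swap_block block_length j (balanced_word X0 X) (balanced_word X0 X')) =
      length (balanced_word X0 (X'(j := X j)))"
    by (simp add: swap_block_def length_balanced_word X X'')
  fix i assume "i < length (swap_block block_length j (balanced_word X0 X) (balanced_word X0 X'))"
  then have i: "i < 2 * n * block_length" by (simp add: swap_block_def length_balanced_word X)
  then have l: "0 < block_length" by (cases block_length) auto
  have "swap_block block_length j (balanced_word X0 X) (balanced_word X0 X') ! i =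
      (if i div block_length = j then balanced_word X0 X ! i else balanced_word X0 X' ! i)"
    using i by (simp add: swap_block_def length_balanced_word X)
  also have "\<dots> = balanced_word X0 (X'(j := X j)) ! i"
  proof (cases "i < n * block_length")
    case True
    then show ?thesis using nth_balanced_word X X'' by simp
  next
    case False
    then have "n \<le> i div block_length" using l by (simp add: less_eq_div_iff_mult_less_eq)
    with False j show ?thesis using X X''
      by (simp add: balanced_word_def nth_append length_blocks)
  qed
  finally show "swap_block block_length j (balanced_word X0 X) (balanced_word X0 X') ! i =
      balanced_word X0 (X'(j := X j)) ! i" .
qed

lemma finite_exponent_lists: "finite exponent_lists"
  and card_exponent_lists: "card exponent_lists = (K ^ M) ^ n"
  and finite_exponents: "finite exponents"
  and card_exponents: "card exponents = K ^ M"
  by (simp_all add: exponent_lists_def exponents_def finite_PiE card_PiE)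

text \<open>Two rows of the family that agree off the blocks \<open>j\<close> and \<open>k\<close> also agree in block \<open>j\<close>, since
  replacing this block does not change the sum, and then in block \<open>k\<close>, because their sums are equal.
  Therefore a row is determined by its \<open>n - 2\<close> other blocks.\<close>

lemma card_swap_closed_le:
  assumes X0: "X0 \<in> exponent_lists" and S: "S \<subseteq> exponent_lists" and jk: "j < n" "k < n" "j \<noteq> k"
    and total: "\<And>X. X \<in> S \<Longrightarrow> total X = total X0"
    and swap: "\<And>X X'. X \<in> S \<Longrightarrow> X' \<in> S \<Longrightarrow>
      agree_off_blocks block_length {j, k} (balanced_word X0 X) (balanced_word X0 X') \<Longrightarrow>
      swap_block block_length j (balanced_word X0 X) (balanced_word X0 X') \<in> word_problem G A"
  shows "card S \<le> (K ^ M) ^ (n - 2)"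
proof -
  let ?I = "{..<n} - {j, k}"
  have "inj_on (\<lambda>X. restrict X ?I) S"
  proof (rule inj_onI)
    fix X X' assume XS: "X \<in> S" "X' \<in> S" and eq: "restrict X ?I = restrict X' ?I"
    have X: "X \<in> exponent_lists" "X' \<in> exponent_lists" using XS S by auto
    have off: "X j' = X' j'" if "j' < n" "j' \<notin> {j, k}" for j'
      using fun_cong[OF eq, of j'] that by simp
    have X'': "X'(j := X j) \<in> exponent_lists"
      using X jk by (auto simp: exponent_lists_def PiE_iff extensional_def)
    have "balanced_word X0 (X'(j := X j)) \<in> word_problem G A"
      using swap[OF XS agree_off_blocks_balanced_word[OF X X0 off]] swap_block_balanced_word[OF X X0 jk(1)]
      by simp
    then have tot: "total (X'(j := X j)) = total X'" "total X = total X'"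
      using balanced_word_in_word_problem_iff[OF X'' X0] total XS by simp_all
    have Xj: "X j i = X' j i" if "i < M" for i
    proof -
      have "(\<Sum>j'<n. (X'(j := X j)) j' i) = (\<Sum>j'<n. X' j' i)"
        using fun_cong[OF tot(1), of i] that by (simp add: total_def)
      then show ?thesis using jk(1)
        by (simp add: sum.remove[of "{..<n}" j])
    qed
    have Xk: "X k i = X' k i" if "i < M" for i
    proof -
      have "(\<Sum>j'<n. X j' i) = (\<Sum>j'<n. X' j' i)"
        using fun_cong[OF tot(2), of i] that by (simp add: total_def)
      moreover have "(\<Sum>j'\<in>{..<n} - {k}. X j' i) = (\<Sum>j'\<in>{..<n} - {k}. X' j' i)"
        using off Xj[OF that] by (intro sum.cong) (auto, metis)
      ultimately show ?thesis using jk(2)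
        by (simp add: sum.remove[of "{..<n}" k])
    qed
    have "X j' i = X' j' i" if "j' < n" "i < M" for j' i
      using off Xj Xk that by (cases "j' = j"; cases "j' = k") auto
    with X show "X = X'"
      by (intro PiE_ext[of X "{..<n}" "\<lambda>_. exponents" X'])
        (auto simp: exponent_lists_def exponents_def intro!: PiE_ext[of _ "{..<M}" "\<lambda>_. {..<K}"])
  qed
  moreover have "(\<lambda>X. restrict X ?I) ` S \<subseteq> ?I \<rightarrow>\<^sub>E exponents"
  proof (rule image_subsetI)
    fix X assume "X \<in> S"
    then have "X j' \<in> exponents" if "j' < n" for j'
      using S that by (auto simp: exponent_lists_def)
    then show "restrict X ?I \<in> ?I \<rightarrow>\<^sub>E exponents" by (simp add: restrict_PiE_iff)
  qed
  ultimately have "card S \<le> card (?I \<rightarrow>\<^sub>E exponents)"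
    by (intro card_inj_on_le) (auto intro!: finite_PiE finite_exponents)
  also have "\<dots> = (K ^ M) ^ (n - 2)"
    using jk by (simp add: card_PiE card_exponents numeral_2_eq_2)
  finally show ?thesis .
qed

end

text \<open>The bounds below combine to
  \<open>(K\<^sup>M)\<^sup>n \<le> (n * K)\<^sup>M * C * (N + 1)\<^sup>e * (K\<^sup>M)\<^sup>n\<^sup>-\<^sup>2\<close>, where the word length \<open>N\<close> is linear in \<open>K\<close>.
  After cancellation \<open>K\<^sup>M\<close> is at most a constant times \<open>K\<^sup>e\<close>.\<close>

theorem (in group) infinite_rank_imp_not_poly_context_free:
  assumes h: "h \<in> hom (free_Abelian_group (UNIV :: nat set)) G" "inj h"
  shows "\<not> poly_context_free G"
proof
  assume "poly_context_free G"
  then obtain A \<L> where A: "symmetric_generating_set G A"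
    and \<L>: "finite \<L>" "\<forall>L\<in>\<L>. context_free L" "word_problem G A = \<Inter>\<L>"
    unfolding poly_context_free_def poly_context_free_language_def by blast
  obtain C e m where swap: "\<And>p q l N R. block_family m p q l N R \<and> (\<forall>L\<in>\<L>. R \<subseteq> L) \<longrightarrow>
    (\<exists>R' j k. R' \<subseteq> R \<and> j \<in> p \<and> k \<in> q \<and> card R \<le> C * (N + 1)^e * card R' \<and>
      (\<forall>L\<in>\<L>. swaps_into l j k R' L))"
    using poly_context_free_swap_blocks[OF \<L>(1,2)] by metis
  have "\<exists>w\<in>lists A. word_value G w = h (frag_of i)" for i
  proof -
    have "h (frag_of i) \<in> carrier G" using hom_carrier[OF h(1)] by auto
    from word_over_symmetric_generating_set[OF A this] show ?thesis by metis
  qed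
  then obtain U where U: "\<And>i. U i \<in> lists A" "\<And>i. word_value G (U i) = h (frag_of i)" by metis
  \<comment> \<open>\<open>M\<close> only has to exceed the degree \<open>e\<close>; \<open>n\<close> provides two reservoirs of \<open>m + 1\<close> blocks, and
    \<open>K0\<close> is the constant that bounds \<open>K\<close> in the end.\<close>
  define M n D where "M = e + 1" and "n = 2 * (m + 1)" and "D = (\<Sum>i<M. length (U i))"
  define K0 where "K0 = n ^ M * C * (2 * n * D + 1) ^ e"
  define K where "K = K0 + 1"
  have pos: "1 \<le> K" "0 < M" "2 \<le> n" by (simp_all add: K_def M_def n_def)
  interpret W: free_abelian_words G A h U M K n
    using A U h by unfold_locales (auto simp: symmetric_generating_set_def)
  let ?l = "W.block_length" and ?N = "2 * n * W.block_length"
  have lD: "?l = K * D" by (simp add: W.block_length_def D_def)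
  have "0 < length (U 0)" using W.U_nonempty by simp
  also have "length (U 0) \<le> D" unfolding D_def using pos by (intro member_le_sum) auto
  finally have l1: "1 \<le> ?l" using pos lD by simp

  have "card W.exponent_lists \<noteq> 0" using pos by (simp add: W.card_exponent_lists)
  then have nonempty: "W.exponent_lists \<noteq> {}" by auto
  have totals: "W.total ` W.exponent_lists \<subseteq> {..<M} \<rightarrow>\<^sub>E {..<n * K}"
  proof (rule image_subsetI)
    fix X assume X: "X \<in> W.exponent_lists"
    have "(\<Sum>j<n. X j i) < n * K" if "i < M" for i
    proof -
      have "(\<Sum>j<n. X j i) < (\<Sum>j<n. K)"
        using W.exponent_lists_less[OF X _ that] pos by (intro sum_strict_mono) (auto simp: lessThan_empty_iff)
      then show ?thesis by simp
    qed
    then show "W.total X \<in> {..<M} \<rightarrow>\<^sub>E {..<n * K}" by (simp add: W.total_def restrict_PiE_iff)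
  qed
  have finite_totals: "finite ({..<M} \<rightarrow>\<^sub>E {..<n * K})" by (simp add: finite_PiE)
  obtain t where t: "card W.exponent_lists \<le>
      card ({..<M} \<rightarrow>\<^sub>E {..<n * K}) * card {X \<in> W.exponent_lists. W.total X = t}"
    using pigeonhole_fiber[OF finite_totals totals W.finite_exponent_lists nonempty] .
  define S where "S = {X \<in> W.exponent_lists. W.total X = t}"
  have S: "S \<subseteq> W.exponent_lists" "finite S"
    using W.finite_exponent_lists by (auto simp: S_def)
  have cardS: "(K ^ M) ^ n \<le> (n * K) ^ M * card S"
    using t by (simp add: S_def W.card_exponent_lists card_PiE)
  moreover have "0 < (K ^ M) ^ n" using pos by simp
  ultimately have "0 < card S" by (metis gr0I mult_0_right not_le)
  then obtain X0 where X0: "X0 \<in> S" by (metis all_not_in_conv card.empty less_irrefl)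
  then have X0E: "X0 \<in> W.exponent_lists" using S by blast
  define R where "R = W.balanced_word X0 ` S"
  have inj: "inj_on (W.balanced_word X0) S"
    using W.inj_on_balanced_word S(1) by (rule inj_on_subset)
  then have cardR: "card R = card S" by (simp add: R_def card_image)
  have "R \<subseteq> word_problem G A"
    using W.balanced_word_in_word_problem_iff[OF _ X0E] X0 by (auto simp: R_def S_def)
  moreover have "block_family m {..<m + 1} {m + 1..<n} ?l ?N R"
  proof -
    have "j * ?l + ?l \<le> ?N" if "j < n" for j
    proof -
      have "(j + 1) * ?l \<le> n * ?l" using that by (intro mult_le_mono1) simp
      then show ?thesis by simp
    qed
    then show ?thesis
      using l1 S X0E W.length_balanced_word by (auto simp: block_family_def R_def n_def)
  qed
  ultimately obtain R' j k where R': "R' \<subseteq> R" "j \<in> {..<m + 1}" "k \<in> {m + 1..<n}"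
    and cardR': "card R \<le> C * (?N + 1)^e * card R'" and into: "\<forall>L\<in>\<L>. swaps_into ?l j k R' L"
    using swap[of "{..<m + 1}" "{m + 1..<n}" ?l ?N R] \<L>(3) by blast
  define S' where "S' = {X \<in> S. W.balanced_word X0 X \<in> R'}"
  have "W.balanced_word X0 ` S' = R'" using R'(1) by (auto simp: S'_def R_def)
  moreover have "inj_on (W.balanced_word X0) S'"
    using inj by (rule inj_on_subset) (auto simp: S'_def)
  ultimately have "card R' = card S'" by (metis card_image)
  also have "card S' \<le> (K ^ M) ^ (n - 2)"
  proof (rule W.card_swap_closed_le[OF X0E])
    show "swap_block ?l j (W.balanced_word X0 X) (W.balanced_word X0 X') \<in> word_problem G A"
      if "X \<in> S'" "X' \<in> S'" "agree_off_blocks ?l {j, k} (W.balanced_word X0 X) (W.balanced_word X0 X')"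
      for X X'
      using that into \<L>(3) by (auto simp: swaps_into_def S'_def)
  qed (use R' S X0 in \<open>auto simp: S'_def S_def n_def\<close>)
  finally have "card S \<le> C * (?N + 1)^e * (K ^ M) ^ (n - 2)"
    using cardR' cardR by (metis mult_le_mono2 order_trans)
  with cardS have "(K ^ M) ^ n \<le> (n * K) ^ M * (C * (?N + 1)^e * (K ^ M) ^ (n - 2))"
    by (meson mult_le_mono2 order_trans)
  moreover have "(K ^ M) ^ n = K ^ M * K ^ M * (K ^ M) ^ (n - 2)"
    using pos(3) by (metis power2_eq_square power_add le_add_diff_inverse)
  ultimately have "(K ^ M) * (K ^ M * (K ^ M) ^ (n - 2)) \<le>
      (n ^ M * (C * (?N + 1)^e)) * (K ^ M * (K ^ M) ^ (n - 2))"
    by (simp only: power_mult_distrib mult_ac)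
  then have "K ^ M \<le> n ^ M * (C * (?N + 1)^e)" using pos(1) by simp
  also have "(?N + 1)^e \<le> (K * (2 * n * D + 1))^e"
    using pos(1) by (intro power_mono) (simp_all add: lD algebra_simps)
  also have "n ^ M * (C * (K * (2 * n * D + 1))^e) = K0 * K ^ e"
    by (simp only: K0_def power_mult_distrib mult_ac)
  also have "K ^ M = K * K ^ e" by (simp add: M_def)
  finally have "K \<le> K0" using pos(1) by simp
  then show False by (simp add: K_def)
qed

section \<open>Finitely presented groups and limits of homomorphisms\<close>

text \<open>The homomorphism from the free group on \<open>S\<close> determined by the images \<open>\<phi>\<close> of the
  generators. It makes sense on words that are not reduced as well, and it is invariant under
  reduction.\<close>

definition free_extension :: "('a, 'b) monoid_scheme \<Rightarrow> ('x \<Rightarrow> 'a) \<Rightarrow> 'x letter list \<Rightarrow> 'a" where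
  "free_extension G \<phi> w =
     foldr (\<lambda>(x, b) g. (if b then \<phi> x else inv\<^bsub>G\<^esub> (\<phi> x)) \<otimes>\<^bsub>G\<^esub> g) w \<one>\<^bsub>G\<^esub>"

lemma free_extension_simps:
  "free_extension G \<phi> [] = \<one>\<^bsub>G\<^esub>"
  "free_extension G \<phi> ((x, b) # w) =
     (if b then \<phi> x else inv\<^bsub>G\<^esub> (\<phi> x)) \<otimes>\<^bsub>G\<^esub> free_extension G \<phi> w"
  by (simp_all add: free_extension_def)

lemma (in group) free_extension_closed:
  "\<phi> ` S \<subseteq> carrier G \<Longrightarrow> w \<in> lists (S \<times> UNIV) \<Longrightarrow> free_extension G \<phi> w \<in> carrier G"
  by (induction w) (auto simp: free_extension_simps)

lemma (in group) free_extension_cons_letter: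
  assumes \<phi>: "\<phi> ` S \<subseteq> carrier G" and "x \<in> S" "w \<in> lists (S \<times> UNIV)"
  shows "free_extension G \<phi> (cons_letter (x, b) w) = free_extension G \<phi> ((x, b) # w)"
proof (cases w)
  case (Cons l w')
  have c: "\<phi> x \<in> carrier G" "free_extension G \<phi> w' \<in> carrier G"
    using assms Cons free_extension_closed[OF \<phi>, of w'] by auto
  then show ?thesis
    using Cons by (auto simp: free_extension_simps m_assoc[symmetric])
qed simp

lemma (in group) free_extension_hom:
  assumes \<phi>: "\<phi> ` S \<subseteq> carrier G"
  shows "free_extension G \<phi> \<in> hom (free_group S) G"
proof (rule homI)
  show "free_extension G \<phi> w \<in> carrier G" if "w \<in> carrier (free_group S)" for w
    using that free_extension_closed[OF \<phi>] by (simp add: free_group_def)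
  fix u w assume u: "u \<in> carrier (free_group S)" and w: "w \<in> carrier (free_group S)"
  have "u \<in> lists (S \<times> UNIV)" using u by (simp add: free_group_def)
  then have "free_extension G \<phi> (foldr cons_letter u w) = free_extension G \<phi> u \<otimes> free_extension G \<phi> w"
  proof (induction u)
    case Nil
    then show ?case using w free_extension_closed[OF \<phi>] by (simp add: free_extension_simps free_group_def)
  next
    case (Cons l u)
    obtain x b where l: "l = (x, b)" by (cases l)
    have f: "foldr cons_letter u w \<in> lists (S \<times> UNIV)"
      using foldr_cons_letter_closed[OF Cons.hyps(2) w] by (simp add: free_group_def)
    have c: "\<phi> x \<in> carrier G" "free_extension G \<phi> u \<in> carrier G" "free_extension G \<phi> w \<in> carrier G"
      using Cons.hyps l \<phi> w free_extension_closed[OF \<phi>] by (auto simp: free_group_def)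
    have "x \<in> S" using Cons.hyps l by simp
    from free_extension_cons_letter[OF \<phi> this f, of b] show ?case
      using Cons.IH l c by (simp add: free_extension_simps m_assoc)
  qed
  then show "free_extension G \<phi> (u \<otimes>\<^bsub>free_group S\<^esub> w) = free_extension G \<phi> u \<otimes> free_extension G \<phi> w"
    by (simp add: free_group_def)
qed

lemma (in group) hom_free_group_eq_free_extension:
  assumes \<pi>: "\<pi> \<in> hom (free_group S) G" and w: "w \<in> carrier (free_group S)"
  shows "\<pi> w = free_extension G (\<lambda>x. \<pi> [(x, True)]) w"
proof -
  interpret F: group "free_group S" by (rule group_free_group)
  interpret \<pi>: group_hom "free_group S" G \<pi> using \<pi> by unfold_locales
  have letter: "[(x, b)] \<in> carrier (free_group S)" if "x \<in> S" for x b
    using that by (simp add: free_group_def reduced_def)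
  have inv: "\<pi> [(x, False)] = inv (\<pi> [(x, True)])" if "x \<in> S" for x
  proof -
    have "[(x, False)] \<otimes>\<^bsub>free_group S\<^esub> [(x, True)] = \<one>\<^bsub>free_group S\<^esub>"
      by (simp add: free_group_def)
    then have "\<pi> [(x, False)] \<otimes> \<pi> [(x, True)] = \<one>"
      using \<pi>.hom_mult[OF letter letter] \<pi>.hom_one that by metis
    then show ?thesis using letter[OF that] by (simp add: inv_equality)
  qed
  from w show ?thesis
  proof (induction w)
    case Nil
    have "[] = \<one>\<^bsub>free_group S\<^esub>" by (simp add: free_group_def)
    then show ?case using \<pi>.hom_one by (simp add: free_extension_simps)
  next
    case (Cons l w)
    obtain x b where l: "l = (x, b)" by (cases l)
    have w: "w \<in> carrier (free_group S)" and x: "x \<in> S"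
      using Cons.prems l by (auto simp: free_group_def reduced_def successively_Cons)
    have "[l] \<otimes>\<^bsub>free_group S\<^esub> w = l # w"
      using Cons.prems by (cases w) (auto simp: free_group_def reduced_def)
    then have "\<pi> (l # w) = \<pi> [l] \<otimes> \<pi> w"
      using \<pi>.hom_mult[OF letter[OF x] w] l by metis
    then show ?case
      using Cons.IH[OF w] inv[OF x] l by (simp add: free_extension_simps)
  qed
qed

lemma (in group) normal_closure_normal:
  assumes "R \<subseteq> carrier G"
  shows "normal_closure G R \<lhd> G"
proof -
  have "carrier G \<lhd> G" by (rule normal_invI[OF subgroup_self]) simp
  then have ne: "{N. N \<lhd> G \<and> R \<subseteq> N} \<noteq> {}" using assms by blast
  have "subgroup (normal_closure G R) G"
    unfolding normal_closure_def using ne by (intro subgroups_Inter) (auto simp: normal_inv_iff)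
  then show ?thesis
    by (rule normal_invI) (auto simp: normal_closure_def normal.inv_op_closed2)
qed

lemma (in group_hom) normal_closure_subset_kernel:
  assumes "R \<subseteq> carrier G" "\<And>r. r \<in> R \<Longrightarrow> h r = \<one>\<^bsub>H\<^esub>"
  shows "normal_closure G R \<subseteq> kernel G H h"
  unfolding normal_closure_def using assms normal_kernel by (auto simp: kernel_def)

lemma presented_group_hom:
  assumes Q: "group Q" and R: "R \<subseteq> carrier (free_group S)"
    and \<rho>: "\<rho> \<in> hom (free_group S) Q" "\<And>r. r \<in> R \<Longrightarrow> \<rho> r = \<one>\<^bsub>Q\<^esub>"
  obtains \<psi> where "\<psi> \<in> hom (presented_group S R) Q"
    "\<And>w. w \<in> carrier (free_group S) \<Longrightarrow>
      \<psi> (normal_closure (free_group S) R #>\<^bsub>free_group S\<^esub> w) = \<rho> w"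
proof -
  interpret F: group "free_group S" by (rule group_free_group)
  interpret Q: group Q by (rule Q)
  interpret \<rho>: group_hom "free_group S" Q \<rho> using \<rho>(1) by unfold_locales
  let ?N = "normal_closure (free_group S) R"
  have N: "?N \<lhd> free_group S" by (rule F.normal_closure_normal[OF R])
  have ker: "?N \<subseteq> kernel (free_group S) Q \<rho>"
    by (rule \<rho>.normal_closure_subset_kernel[OF R \<rho>(2)])
  show thesis
  proof (rule FactGroup_universal[OF \<rho>(1) N])
    fix x y assume xy: "x \<in> carrier (free_group S)" "y \<in> carrier (free_group S)"
      "?N #>\<^bsub>free_group S\<^esub> x = ?N #>\<^bsub>free_group S\<^esub> y"
    interpret N: normal ?N "free_group S" by (rule N)
    have "x \<in> ?N #>\<^bsub>free_group S\<^esub> y"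
      using F.rcos_self[OF xy(1) N.subgroup_axioms] xy(3) by simp
    then obtain m where m: "m \<in> ?N" "x = m \<otimes>\<^bsub>free_group S\<^esub> y" by (auto simp: r_coset_def)
    then have "\<rho> m = \<one>\<^bsub>Q\<^esub>" using ker by (auto simp: kernel_def)
    then show "\<rho> x = \<rho> y" using m xy N.subset by (auto simp: \<rho>.hom_mult subset_iff)
  next
    fix \<psi> assume "\<psi> \<in> hom (free_group S Mod ?N) Q"
      "\<And>x. x \<in> carrier (free_group S) \<Longrightarrow> \<psi> (?N #>\<^bsub>free_group S\<^esub> x) = \<rho> x"
    then show thesis by (intro that) (simp_all add: presented_group_def)
  qed
qed

text \<open>Maps that become multiplicative in the limit give rise to homomorphisms \<open>\<rho> n\<close> on the free group
  over the generators of a presentation, and \<open>\<rho> n\<close> agrees with \<open>\<Lambda> n\<close> on every fixed word for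
  large \<open>n\<close>. Finitely many relators are therefore killed by \<open>\<rho> n\<close> for large \<open>n\<close>, and
  \<open>\<rho> n\<close> factors through \<open>G\<close>.\<close>

lemma finitely_presented_eventually_hom:
  assumes G: "group G" and Q: "group Q" and fp: "finitely_presented G"
    and closed: "\<And>n g. g \<in> carrier G \<Longrightarrow> \<Lambda> n g \<in> carrier Q"
    and mult: "\<And>g g'. g \<in> carrier G \<Longrightarrow> g' \<in> carrier G \<Longrightarrow>
      \<forall>\<^sub>F n in sequentially. \<Lambda> n (g \<otimes>\<^bsub>G\<^esub> g') = \<Lambda> n g \<otimes>\<^bsub>Q\<^esub> \<Lambda> n g'"
    and E: "finite E" "E \<subseteq> carrier G"
  shows "\<forall>\<^sub>F n in sequentially. \<exists>\<psi> \<in> hom G Q. \<forall>g\<in>E. \<psi> g = \<Lambda> n g"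
proof -
  interpret G: group G by (rule G)
  interpret Q: group Q by (rule Q)
  obtain S :: "nat set" and R where R: "finite R" "R \<subseteq> carrier (free_group S)"
    and iso: "G \<cong> presented_group S R"
    using fp unfolding finitely_presented_def by blast
  interpret F: group "free_group S" by (rule group_free_group)
  let ?N = "normal_closure (free_group S) R"
  interpret N: normal ?N "free_group S" by (rule F.normal_closure_normal[OF R(2)])
  obtain f where f: "f \<in> iso G (presented_group S R)" using iso by (auto simp: is_iso_def)
  define f' where "f' = inv_into (carrier G) f"
  have f': "f' \<in> iso (presented_group S R) G" unfolding f'_def by (rule G.iso_set_sym[OF f])
  have ff': "f (f' y) = y" if "y \<in> carrier (presented_group S R)" for y
    using that f f_inv_into_f[of y f "carrier G"] by (auto simp: f'_def iso_def bij_betw_def)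
  have f'f: "f' (f g) = g" if "g \<in> carrier G" for g
    using that f inv_into_f_f[of f "carrier G"] by (auto simp: f'_def iso_def bij_betw_def)
  have f_hom: "f \<in> hom G (presented_group S R)" and f'_hom: "f' \<in> hom (presented_group S R) G"
    using f f' by (auto simp: iso_def)
  define \<pi> where "\<pi> = f' \<circ> (\<lambda>w. ?N #>\<^bsub>free_group S\<^esub> w)"
  have q_hom: "(\<lambda>w. ?N #>\<^bsub>free_group S\<^esub> w) \<in> hom (free_group S) (presented_group S R)"
    using N.r_coset_hom_Mod by (simp add: presented_group_def)
  have \<pi>: "\<pi> \<in> hom (free_group S) G"
    unfolding \<pi>_def by (rule hom_compose[OF q_hom f'_hom])
  define \<gamma> where "\<gamma> x = \<pi> [(x, True)]" for x
  have \<gamma>: "\<gamma> ` S \<subseteq> carrier G"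
    using hom_carrier[OF \<pi>] by (auto simp: \<gamma>_def free_group_def reduced_def)
  have \<pi>_eq: "\<pi> w = free_extension G \<gamma> w" if "w \<in> carrier (free_group S)" for w
    unfolding \<gamma>_def by (rule G.hom_free_group_eq_free_extension[OF \<pi> that])
  have f\<pi>: "f (\<pi> w) = ?N #>\<^bsub>free_group S\<^esub> w" if "w \<in> carrier (free_group S)" for w
    using that hom_carrier[OF q_hom] by (auto simp: \<pi>_def intro!: ff')
  have surj: "\<exists>w\<in>carrier (free_group S). \<pi> w = g" if "g \<in> carrier G" for g
  proof -
    have "f g \<in> carrier (free_group S Mod ?N)"
      using that hom_carrier[OF f_hom] by (auto simp: presented_group_def)
    then obtain w where "w \<in> carrier (free_group S)" "f g = ?N #>\<^bsub>free_group S\<^esub> w"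
      by (auto simp: carrier_FactGroup)
    with f'f[OF that] show ?thesis by (auto simp: \<pi>_def)
  qed
  have \<Lambda>_one: "\<forall>\<^sub>F n in sequentially. \<Lambda> n \<one>\<^bsub>G\<^esub> = \<one>\<^bsub>Q\<^esub>"
    using mult[OF G.one_closed G.one_closed]
  proof eventually_elim
    case (elim n)
    then have "\<Lambda> n \<one>\<^bsub>G\<^esub> \<otimes>\<^bsub>Q\<^esub> \<Lambda> n \<one>\<^bsub>G\<^esub> = \<Lambda> n \<one>\<^bsub>G\<^esub>" by simp
    then show ?case using closed[OF G.one_closed] by simp
  qed
  have \<Lambda>_inv: "\<forall>\<^sub>F n in sequentially. \<Lambda> n (inv\<^bsub>G\<^esub> g) = inv\<^bsub>Q\<^esub> (\<Lambda> n g)" if g: "g \<in> carrier G" for g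
    using mult[OF G.inv_closed[OF g] g] \<Lambda>_one
  proof eventually_elim
    case (elim n)
    then show ?case
      using closed[of _ n] g Q.inv_equality[of "\<Lambda> n (inv\<^bsub>G\<^esub> g)" "\<Lambda> n g"] by simp
  qed
  define \<rho> where "\<rho> n = free_extension Q (\<Lambda> n \<circ> \<gamma>)" for n
  have \<rho>: "\<rho> n \<in> hom (free_group S) Q" for n
    unfolding \<rho>_def using \<gamma> closed by (intro Q.free_extension_hom) auto
  have ev: "\<forall>\<^sub>F n in sequentially. \<rho> n w = \<Lambda> n (free_extension G \<gamma> w)"
    if "w \<in> lists (S \<times> UNIV)" for w
    using that
  proof (induction w)
    case Nil
    show ?case using \<Lambda>_one by (simp add: \<rho>_def free_extension_simps eq_commute)
  next
    case (Cons l w)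
    obtain x b where l: "l = (x, b)" by (cases l)
    have x: "\<gamma> x \<in> carrier G" using Cons.hyps l \<gamma> by auto
    have w: "free_extension G \<gamma> w \<in> carrier G"
      using Cons.hyps G.free_extension_closed[OF \<gamma>] by blast
    let ?g = "if b then \<gamma> x else inv\<^bsub>G\<^esub> (\<gamma> x)"
    have g: "?g \<in> carrier G" using x by simp
    show ?case
      using Cons.IH mult[OF g w] \<Lambda>_inv[OF x]
      by eventually_elim (simp add: \<rho>_def free_extension_simps l split: if_splits)
  qed
  have ev_\<pi>: "\<forall>\<^sub>F n in sequentially. \<rho> n w = \<Lambda> n (\<pi> w)" if "w \<in> carrier (free_group S)" for w
    using ev[of w] that by (simp add: \<pi>_eq free_group_def)
  have "\<forall>\<^sub>F n in sequentially. \<forall>r\<in>R. \<rho> n r = \<one>\<^bsub>Q\<^esub>"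
  proof (rule eventually_ball_finite[OF R(1)], rule ballI)
    fix r assume r: "r \<in> R"
    then have rF: "r \<in> carrier (free_group S)" using R(2) by blast
    have "r \<in> ?N" using r by (auto simp: normal_closure_def)
    then have "f (\<pi> r) = ?N" 
      using f\<pi>[OF rF] F.coset_join2[OF rF N.subgroup_axioms] by simp
    also have "?N = f (\<pi> \<one>\<^bsub>free_group S\<^esub>)" 
      using f\<pi>[OF F.one_closed] F.coset_join2[OF F.one_closed N.subgroup_axioms N.one_closed] by simp
    finally have "\<pi> r = \<pi> \<one>\<^bsub>free_group S\<^esub>"
      using f'f hom_carrier[OF \<pi>] rF by (metis F.one_closed image_subset_iff)
    then have "\<pi> r = \<one>\<^bsub>G\<^esub>" using hom_one[OF \<pi> group_free_group G] by simp
    then show "\<forall>\<^sub>F n in sequentially. \<rho> n r = \<one>\<^bsub>Q\<^esub>"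
      using ev_\<pi>[OF rF] \<Lambda>_one by (auto elim: eventually_elim2)
  qed
  moreover obtain u where u: "\<And>g. g \<in> E \<Longrightarrow> u g \<in> carrier (free_group S)" "\<And>g. g \<in> E \<Longrightarrow> \<pi> (u g) = g"
    using surj E(2) by (metis subset_iff)
  have "\<forall>\<^sub>F n in sequentially. \<forall>g\<in>E. \<rho> n (u g) = \<Lambda> n g"
    using u ev_\<pi> by (intro eventually_ball_finite[OF E(1)]) metis
  ultimately show ?thesis
  proof eventually_elim
    case (elim n)
    obtain \<psi> where \<psi>: "\<psi> \<in> hom (presented_group S R) Q"
      "\<And>w. w \<in> carrier (free_group S) \<Longrightarrow> \<psi> (?N #>\<^bsub>free_group S\<^esub> w) = \<rho> n w"
      using presented_group_hom[OF Q R(2) \<rho>[of n]] elim(1) by blast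
    have "\<psi> (f g) = \<Lambda> n g" if "g \<in> E" for g
      using \<psi>(2)[OF u(1)[OF that]] f\<pi>[OF u(1)[OF that]] u(2)[OF that] elim(2) that by simp
    then show ?case
      using hom_compose[OF f_hom \<psi>(1)] by (intro bexI[of _ "\<psi> \<circ> f"]) auto
  qed
qed

section \<open>The wreath product and its action on the comb graph\<close>

abbreviation lamplighter :: "((int \<Rightarrow> int) \<times> int) monoid" where
  "lamplighter \<equiv> wreath_product integer_group integer_group"

lemma lamplighter_simps:
  "(f, s) \<in> carrier lamplighter \<longleftrightarrow> finite {x. f x \<noteq> 0}"
  "(f, s) \<otimes>\<^bsub>lamplighter\<^esub> (f', s') = (\<lambda>x. f x + f' (x - s), s + s')"
  "\<one>\<^bsub>lamplighter\<^esub> = (\<lambda>x. 0, 0)"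
  by (simp_all add: wreath_product_def semidirect_product_def carrier_sum_group fun_eq_iff)

lemma finite_support_add:
  assumes "finite {x. f x \<noteq> (0::int)}" "finite {x. f' x \<noteq> 0}"
  shows "finite {x. f x + f' (x - s :: int) \<noteq> 0}"
proof (rule finite_subset)
  show "{x. f x + f' (x - s) \<noteq> 0} \<subseteq> {x. f x \<noteq> 0} \<union> (\<lambda>x. x + s) ` {x. f' x \<noteq> 0}"
    by (auto intro!: image_eqI[of _ _ "x - s" for x])
qed (use assms in auto)

lemma group_lamplighter: "group lamplighter"
proof (rule groupI)
  fix u v assume "u \<in> carrier lamplighter" "v \<in> carrier lamplighter"
  then show "u \<otimes>\<^bsub>lamplighter\<^esub> v \<in> carrier lamplighter"
    by (cases u; cases v) (simp add: lamplighter_simps finite_support_add)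
next
  fix u assume u: "u \<in> carrier lamplighter"
  obtain f s where fs: "u = (f, s)" by (cases u)
  have "finite ((\<lambda>x. x - s) ` {x. f x \<noteq> 0})" using u by (simp add: fs lamplighter_simps)
  moreover have "{x. - f (x + s) \<noteq> 0} = (\<lambda>x. x - s) ` {x. f x \<noteq> 0}"
    by (auto intro!: image_eqI[of _ _ "x + s" for x])
  ultimately show "\<exists>v\<in>carrier lamplighter. v \<otimes>\<^bsub>lamplighter\<^esub> u = \<one>\<^bsub>lamplighter\<^esub>"
    by (intro bexI[of _ "(\<lambda>x. - f (x + s), - s)"]) (simp_all add: fs lamplighter_simps)
qed (auto simp: lamplighter_simps algebra_simps)

text \<open>Let \<open>a\<close> be the function with the single value \<open>1\<close> at \<open>0\<close> and let \<open>c\<close> be the translation by \<open>1\<close>.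
  Conjugating powers of \<open>a\<close> by powers of \<open>c\<close> gives all functions supported at a single point,
  and these generate the base group.\<close>

lemma subgroup_lamplighter_eq_carrier:
  assumes H: "subgroup H lamplighter"
    and a: "(\<lambda>t. if t = 0 then 1 else 0, 0) \<in> H" and c: "(\<lambda>t. 0, 1) \<in> H"
  shows "H = carrier lamplighter"
proof
  interpret W: group lamplighter by (rule group_lamplighter)
  interpret H: subgroup H lamplighter by (rule H)
  have mult: "(\<lambda>x. f x + f' (x - s), s + s') \<in> H" if "(f, s) \<in> H" "(f', s') \<in> H" for f s f' s'
    using H.m_closed[OF that] by (simp add: lamplighter_simps)
  have inv: "(\<lambda>x. - f (x + s), - s) \<in> H" if "(f, s) \<in> H" for f s
  proof -
    have "finite {x. f x \<noteq> 0}" using H.subset that lamplighter_simps(1) by blast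
    then have "finite ((\<lambda>x. x - s) ` {x. f x \<noteq> 0})" by simp
    moreover have "{x. - f (x + s) \<noteq> 0} = (\<lambda>x. x - s) ` {x. f x \<noteq> 0}"
      by (auto intro!: image_eqI[of _ _ "x + s" for x])
    ultimately have "inv\<^bsub>lamplighter\<^esub> (f, s) = (\<lambda>x. - f (x + s), - s)"
      using that H.subset by (intro W.inv_equality) (auto simp: lamplighter_simps)
    with H.m_inv_closed[OF that] show ?thesis by simp
  qed
  have shift: "(\<lambda>t. 0, s) \<in> H" for s
  proof (induction s rule: int_induct[where k = 0])
    case base
    show ?case using H.one_closed by (simp add: lamplighter_simps)
  next
    case (step1 i)
    show ?case using mult[OF step1(2) c] by simp
  next
    case (step2 i)
    show ?case using mult[OF step2(2) inv[OF c]] by simp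
  qed
  have lamp0: "(\<lambda>t. if t = 0 then k else 0, 0) \<in> H" for k
  proof (induction k rule: int_induct[where k = 0])
    case base
    show ?case using H.one_closed by (simp add: lamplighter_simps)
  next
    case (step1 i)
    have "(\<lambda>t::int. (if t = 0 then i else 0) + (if t - 0 = 0 then 1 else 0)) =
        (\<lambda>t. if t = 0 then i + 1 else 0)" by auto
    with mult[OF step1(2) a] show ?case by simp
  next
    case (step2 i)
    have "(\<lambda>t::int. (if t = 0 then i else 0) + - (if t - 0 + 0 = 0 then 1 else 0)) =
        (\<lambda>t. if t = 0 then i - 1 else 0)" by auto
    with mult[OF step2(2) inv[OF a]] show ?case by simp
  qed
  have lamp: "(\<lambda>t. if t = x then k else 0, 0) \<in> H" for x k
    using mult[OF mult[OF shift[of x] lamp0[of k]] shift[of "- x"]] by simp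
  have base: "\<forall>f. {x. f x \<noteq> 0} \<subseteq> D \<longrightarrow> (f, 0) \<in> H" if "finite D" for D
    using that
  proof (induction D)
    case empty
    show ?case
    proof (intro allI impI)
      fix f :: "int \<Rightarrow> int" assume "{x. f x \<noteq> 0} \<subseteq> {}"
      then have "f = (\<lambda>x. 0)" by auto
      then show "(f, 0) \<in> H" using shift[of 0] by simp
    qed
  next
    case (insert x D)
    show ?case
    proof (intro allI impI)
      fix f :: "int \<Rightarrow> int" assume f: "{t. f t \<noteq> 0} \<subseteq> insert x D"
      have "{t. (f(x := 0)) t \<noteq> 0} \<subseteq> D" using f by auto
      with insert.IH have "(f(x := 0), 0) \<in> H" by blast
      from mult[OF lamp[of x "f x"] this]
      have "(\<lambda>t. (if t = x then f x else 0) + (f(x := 0)) t, 0) \<in> H" by simp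
      moreover have "(\<lambda>t. (if t = x then f x else 0) + (f(x := 0)) t) = f" by auto
      ultimately show "(f, 0) \<in> H" by simp
    qed
  qed
  show "carrier lamplighter \<subseteq> H"
  proof
    fix u assume u: "u \<in> carrier lamplighter"
    obtain f s where fs: "u = (f, s)" by (cases u)
    have "(f, 0) \<in> H" using u base[of "{x. f x \<noteq> 0}"] by (simp add: fs lamplighter_simps)
    from mult[OF this shift[of s]] show "u \<in> H" by (simp add: fs)
  qed
  show "H \<subseteq> carrier lamplighter" by (rule H.subset)
qed

lemma BijGroup_UNIV:
  "g \<in> carrier (BijGroup UNIV) \<longleftrightarrow> bij g"
  "bij g \<Longrightarrow> bij g' \<Longrightarrow> g \<otimes>\<^bsub>BijGroup UNIV\<^esub> g' = g \<circ> g'"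
  by (auto simp: BijGroup_def Bij_def compose_def)

text \<open>The value of \<open>f\<close> is read at the column \<open>x + s\<close> at which the vertex arrives; with this
  convention composition of permutations matches multiplication in the wreath product.\<close>

definition comb_perm :: "(int \<Rightarrow> int) \<times> int \<Rightarrow> int \<times> int \<Rightarrow> int \<times> int" where
  "comb_perm = (\<lambda>(f, s) (x, y). (x + s, y + f (x + s)))"

lemma bij_comb_perm: "bij (comb_perm u)"
proof -
  obtain f s where u: "u = (f, s)" by (cases u)
  show ?thesis
    by (rule o_bij[of "\<lambda>(x, y). (x - s, y - f x)"]) (auto simp: u comb_perm_def fun_eq_iff)
qed

lemma comb_perm_mult:
  "comb_perm (u \<otimes>\<^bsub>lamplighter\<^esub> v) = comb_perm u \<circ> comb_perm v"
  by (cases u; cases v) (auto simp: lamplighter_simps comb_perm_def fun_eq_iff algebra_simps)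

lemma comb_perm_hom: "comb_perm \<in> hom lamplighter (BijGroup UNIV)"
  by (rule homI) (simp_all add: BijGroup_UNIV bij_comb_perm comb_perm_mult)

lemma inj_comb_perm: "inj comb_perm"
proof (rule injI)
  fix u v :: "(int \<Rightarrow> int) \<times> int" assume eq: "comb_perm u = comb_perm v"
  obtain f s g t where fs: "u = (f, s)" "v = (g, t)" by (cases u; cases v)
  have "s = t" using fun_cong[OF eq, of "(0, 0)"] by (simp add: fs comb_perm_def)
  moreover have "f x = g x" for x
    using fun_cong[OF eq, of "(x - s, 0)"] \<open>s = t\<close> by (simp add: fs comb_perm_def)
  ultimately show "u = v" by (auto simp: fs)
qed

lemma transition_perm_comb_graph:
  "transition_perm comb_graph (Gen_c, b) = comb_perm (\<lambda>t. 0, if b then 1 else -1)"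
  "transition_perm comb_graph (Gen_a, b) =
     comb_perm (\<lambda>t. if t = 0 then if b then 1 else -1 else 0, 0)"
proof -
  interpret transition_graph comb_graph by (rule transition_graph_comb)
  have V: "verts comb_graph = UNIV" by (simp add: comb_graph_def)
  show "transition_perm comb_graph (Gen_c, b) = comb_perm (\<lambda>t. 0, if b then 1 else -1)"
    by (auto simp: transition_perm_def V fun_eq_iff comb_perm_def comb_edges_iff intro!: target_eqI)
  show "transition_perm comb_graph (Gen_a, b) =
      comb_perm (\<lambda>t. if t = 0 then if b then 1 else -1 else 0, 0)"
    by (auto simp: transition_perm_def V fun_eq_iff comb_perm_def comb_edges_iff intro!: target_eqI)
qed

lemma group_transition_group_comb: "group (transition_group comb_graph)"
  unfolding transition_group_def by (rule group.group_subgroup_generated[OF group_BijGroup])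

lemma comb_perm_iso: "comb_perm \<in> iso lamplighter (transition_group comb_graph)"
proof -
  let ?B = "BijGroup (UNIV :: (int \<times> int) set)"
  interpret B: group ?B by (rule group_BijGroup)
  interpret W: group lamplighter by (rule group_lamplighter)
  interpret \<Phi>: group_hom lamplighter ?B comb_perm using comb_perm_hom by unfold_locales
  define X where "X = range (transition_perm comb_graph)"
  have G: "transition_group comb_graph = subgroup_generated ?B X"
    by (simp add: transition_group_def comb_graph_def X_def)
  have X: "X \<subseteq> comb_perm ` carrier lamplighter"
  proof
    fix g assume "g \<in> X"
    then obtain l where "g = transition_perm comb_graph l" by (auto simp: X_def)
    then show "g \<in> comb_perm ` carrier lamplighter"
      by (cases l; cases "fst l")
        (auto simp: transition_perm_comb_graph lamplighter_simps intro!: imageI)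
  qed
  then have XB: "X \<subseteq> carrier ?B" by (auto simp: BijGroup_UNIV bij_comb_perm)
  have T: "carrier (transition_group comb_graph) = generate ?B X"
    using XB by (simp add: G carrier_subgroup_generated Int_absorb1)
  interpret T: subgroup "generate ?B X" ?B by (rule B.generate_is_subgroup[OF XB])
  define H where "H = {u \<in> carrier lamplighter. comb_perm u \<in> generate ?B X}"
  have "\<one>\<^bsub>lamplighter\<^esub> \<in> H" by (simp add: H_def)
  then have "H \<noteq> {}" by blast
  then have "subgroup H lamplighter"
    by (rule W.subgroupI[rotated]) (simp_all add: H_def subset_iff)
  moreover have "comb_perm (\<lambda>t. if t = 0 then 1 else 0, 0) = transition_perm comb_graph (Gen_a, True)"
    "comb_perm (\<lambda>t. 0, 1) = transition_perm comb_graph (Gen_c, True)"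
    by (simp_all add: transition_perm_comb_graph)
  ultimately have "H = carrier lamplighter"
    by (intro subgroup_lamplighter_eq_carrier) (auto simp: H_def lamplighter_simps X_def intro!: generate.incl)
  then have "comb_perm ` carrier lamplighter \<subseteq> generate ?B X" by (auto simp: H_def)
  moreover have "generate ?B X \<subseteq> comb_perm ` carrier lamplighter"
    by (rule B.generate_subgroup_incl[OF X \<Phi>.img_is_subgroup])
  ultimately have img: "comb_perm ` carrier lamplighter = carrier (transition_group comb_graph)"
    using T by blast
  show ?thesis
  proof (rule isoI)
    show "comb_perm \<in> hom lamplighter (transition_group comb_graph)"
      using img by (intro homI) (auto simp: G)
    show "bij_betw comb_perm (carrier lamplighter) (carrier (transition_group comb_graph))"
      using img inj_comb_perm by (auto simp: bij_betw_def intro: inj_on_subset)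
  qed
qed

lemma solvable_comm_group: "comm_group G \<Longrightarrow> solvable G"
proof -
  assume G: "comm_group G"
  interpret comm_group G by (rule G)
  have "(derived G ^^ 1) (carrier G) = {\<one>\<^bsub>G\<^esub>}" by (simp add: derived_eq_singleton)
  then show ?thesis using solvable_iff_trivial_derived_seq by blast
qed

lemma solvable_lamplighter: "solvable lamplighter"
proof (rule solvable_condition)
  let ?N = "sum_group (UNIV :: int set) (\<lambda>_. integer_group)"
  have N: "f \<in> carrier ?N \<longleftrightarrow> finite {x. f x \<noteq> 0}" for f
    by (simp add: carrier_sum_group)
  show "group_hom ?N lamplighter (\<lambda>f. (f, 0))"
    using N by (intro group_hom.intro group_lamplighter group_hom_axioms.intro homI)
      (simp_all add: lamplighter_simps fun_eq_iff)
  show "group_hom lamplighter integer_group snd"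
    by (intro group_hom.intro group_lamplighter group_hom_axioms.intro homI)
      (auto simp: lamplighter_simps)
  show "snd ` carrier lamplighter = carrier integer_group"
    by (force simp: lamplighter_simps intro!: image_eqI[of _ snd "(\<lambda>t. 0, s)" for s])
  show "kernel lamplighter integer_group snd \<subseteq> (\<lambda>f. (f, 0)) ` carrier ?N"
    using N by (auto simp: kernel_def lamplighter_simps)
  show "solvable ?N"
  proof (rule solvable_comm_group, rule group.group_comm_groupI)
    show "x \<otimes>\<^bsub>?N\<^esub> y = y \<otimes>\<^bsub>?N\<^esub> x" for x y by (simp add: add.commute)
  qed simp
  show "solvable integer_group" by (rule solvable_comm_group[OF abelian_integer_group])
qed

lemma isomorphic_solvable:
  assumes "group G" "group H" "h \<in> iso G H" "solvable G"
  shows "solvable H"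
proof -
  interpret group_hom G H h
    using assms by (simp add: group_hom_def group_hom_axioms_def iso_def)
  show ?thesis
    using solvable_imp_solvable_img[of "carrier G"] assms(3,4)
    by (simp add: solvable_def iso_def bij_betw_def)
qed

text \<open>The embedding of \<open>\<int>\<^sup>\<infinity>\<close> into the base group, with the \<open>i\<close>-th coordinate placed at \<open>i\<close>.\<close>

definition coordinate_lamps :: "(nat \<Rightarrow>\<^sub>0 int) \<Rightarrow> (int \<Rightarrow> int) \<times> int" where
  "coordinate_lamps p = (\<lambda>x. if 0 \<le> x then poly_mapping.lookup p (nat x) else 0, 0)"

lemma coordinate_lamps_hom: "coordinate_lamps \<in> hom (free_Abelian_group UNIV) lamplighter"
proof (rule homI)
  fix p :: "nat \<Rightarrow>\<^sub>0 int"
  have "{x. (if 0 \<le> x then poly_mapping.lookup p (nat x) else 0) \<noteq> 0} \<subseteq> int ` Poly_Mapping.keys p"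
    by (auto simp: in_keys_iff split: if_splits intro!: image_eqI[of _ int "nat x" for x])
  then show "coordinate_lamps p \<in> carrier lamplighter"
    unfolding coordinate_lamps_def lamplighter_simps by (rule finite_subset) simp
qed (auto simp: coordinate_lamps_def lamplighter_simps lookup_add)

lemma inj_coordinate_lamps: "inj coordinate_lamps"
proof (rule injI)
  fix p q assume eq: "coordinate_lamps p = coordinate_lamps q"
  have "poly_mapping.lookup p i = poly_mapping.lookup q i" for i
  proof -
    have "fst (coordinate_lamps p) (int i) = fst (coordinate_lamps q) (int i)" by (simp add: eq)
    then show ?thesis by (simp add: coordinate_lamps_def)
  qed
  then show "p = q" by (simp add: poly_mapping_eqI)
qed

lemma embedding_imp_isomorphic_subgroup:
  assumes "group F" "group G" "h \<in> hom F G" "inj_on h (carrier F)"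
  shows "subgroup (h ` carrier F) G" "G\<lparr>carrier := h ` carrier F\<rparr> \<cong> F"
proof -
  interpret group_hom F G h using assms by (simp add: group_hom_def group_hom_axioms_def)
  show "subgroup (h ` carrier F) G" by (rule img_is_subgroup)
  have "h \<in> iso F (G\<lparr>carrier := h ` carrier F\<rparr>)"
    using assms(4) by (auto simp: iso_def hom_def bij_betw_def)
  then show "G\<lparr>carrier := h ` carrier F\<rparr> \<cong> F"
    by (intro G.iso_sym) (rule is_isoI)
qed

section \<open>Failure of finite presentability\<close>

text \<open>The powers of a permutation of \<open>\<int>\<close> that does not commute with the translation by \<open>1\<close>;
  they preserve parity, hence add up.\<close>

definition twist :: "int \<Rightarrow> int \<Rightarrow> int" where
  "twist k y = (if even y then y + 2 * k else y)"

lemma twist_0 [simp]: "twist 0 y = y"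
  by (simp add: twist_def)

lemma twist_add: "twist (k + l) y = twist k (twist l y)"
  by (simp add: twist_def)

text \<open>The wreath product acts here as if the generator \<open>a\<close> were the translation on column \<open>0\<close>
  and the twist on column \<open>n\<close>. For fixed \<open>n\<close> this is not a homomorphism, because the two
  permutations do not commute.\<close>

definition two_column_perm :: "nat \<Rightarrow> (int \<Rightarrow> int) \<times> int \<Rightarrow> int \<times> int \<Rightarrow> int \<times> int" where
  "two_column_perm n = (\<lambda>(f, s) (x, y). (x + s, f (x + s) + twist (f (x + s - int n)) y))"

lemma bij_two_column_perm: "bij (two_column_perm n u)"
proof -
  obtain f s where u: "u = (f, s)" by (cases u)
  show ?thesis
    by (rule o_bij[of "\<lambda>(x, y). (x - s, twist (- f (x - int n)) (y - f x))"])
      (auto simp: u two_column_perm_def fun_eq_iff simp flip: twist_add)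
qed

text \<open>The order of translation and twist matters only if the left factor twists and the right factor
  translates at the same column. For \<open>n\<close> larger than the extent of both supports and the shift
  this does not occur.\<close>

lemma two_column_perm_eventually_mult:
  assumes "u \<in> carrier lamplighter" "v \<in> carrier lamplighter"
  shows "\<forall>\<^sub>F n in sequentially.
    two_column_perm n (u \<otimes>\<^bsub>lamplighter\<^esub> v) = two_column_perm n u \<circ> two_column_perm n v"
proof -
  obtain f s g r where uv: "u = (f, s)" "v = (g, r)" by (cases u; cases v)
  have bound: "\<exists>b::int. \<forall>x\<in>D. \<bar>x\<bar> \<le> b" if "finite D" for D
    using that by (intro exI[of _ "Max (abs ` D)"]) auto
  obtain b b' where b: "\<And>x. f x \<noteq> 0 \<Longrightarrow> \<bar>x\<bar> \<le> b" "\<And>x. g x \<noteq> 0 \<Longrightarrow> \<bar>x\<bar> \<le> b'"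
    using assms bound[of "{x. f x \<noteq> 0}"] bound[of "{x. g x \<noteq> 0}"] by (auto simp: uv lamplighter_simps)
  show ?thesis
    using eventually_gt_at_top[of "nat (b + b' + \<bar>s\<bar>)"]
  proof eventually_elim
    case (elim n)
    have disj: "f (t - int n) = 0 \<or> g (t - s) = 0" for t
      using b(1)[of "t - int n"] b(2)[of "t - s"] elim by linarith
    have "two_column_perm n (u \<otimes>\<^bsub>lamplighter\<^esub> v) (x, y) = two_column_perm n u (two_column_perm n v (x, y))" for x y
      using disj[of "x + r + s"]
      by (auto simp: uv lamplighter_simps two_column_perm_def twist_add algebra_simps)
    then show ?case by (auto simp: fun_eq_iff)
  qed
qed

text \<open>Besides \<open>a\<close> and \<open>c\<close>, no values of the homomorphism \<open>\<psi>\<close> are prescribed. They suffice to compute it on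
  the conjugate \<open>a'\<close> of \<open>a\<close> by \<open>c\<^sup>n\<close>, which moves column \<open>n\<close> by the translation, whereas \<open>a\<close>
  itself moves this column by the twist.\<close>

lemma lamplighter_not_finitely_presented: "\<not> finitely_presented lamplighter"
proof
  assume fp: "finitely_presented lamplighter"
  let ?Q = "BijGroup (UNIV :: (int \<times> int) set)"
  interpret W: group lamplighter by (rule group_lamplighter)
  interpret Q: group ?Q by (rule group_BijGroup)
  define a c :: "(int \<Rightarrow> int) \<times> int" where "a = (\<lambda>t. if t = 0 then 1 else 0, 0)" and "c = (\<lambda>t. 0, 1)"
  have ac: "a \<in> carrier lamplighter" "c \<in> carrier lamplighter"
    by (simp_all add: a_def c_def lamplighter_simps)
  have "\<forall>\<^sub>F n in sequentially. \<exists>\<psi>\<in>hom lamplighter ?Q. \<forall>g\<in>{a, c}. \<psi> g = two_column_perm n g"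
    using ac two_column_perm_eventually_mult
    by (intro finitely_presented_eventually_hom[OF W.is_group Q.is_group fp])
      (auto simp: BijGroup_UNIV bij_two_column_perm)
  then have "\<forall>\<^sub>F n in sequentially. 0 < n \<and> (\<exists>\<psi>\<in>hom lamplighter ?Q. \<forall>g\<in>{a, c}. \<psi> g = two_column_perm n g)"
    using eventually_gt_at_top[of 0] by eventually_elim simp
  then obtain n \<psi> where n: "0 < n" and \<psi>: "\<psi> \<in> hom lamplighter ?Q"
    "\<psi> a = two_column_perm n a" "\<psi> c = two_column_perm n c"
    using eventually_happens'[OF sequentially_bot] by blast
  interpret \<psi>: group_hom lamplighter ?Q \<psi> using \<psi>(1) by unfold_locales
  have bij: "bij (\<psi> u)" if "u \<in> carrier lamplighter" for u
    using \<psi>.hom_closed[OF that] by (simp add: BijGroup_UNIV)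
  have \<psi>_mult: "\<psi> (u \<otimes>\<^bsub>lamplighter\<^esub> v) = \<psi> u \<circ> \<psi> v"
    if "u \<in> carrier lamplighter" "v \<in> carrier lamplighter" for u v
    using that by (simp add: BijGroup_UNIV bij)
  have \<psi>a: "\<psi> a (x, y) = (x, (if x = 0 then 1 else 0) + twist (if x = int n then 1 else 0) y)" for x y
    unfolding \<psi>(2) by (simp add: two_column_perm_def a_def)
  have \<psi>c: "\<psi> c (x, y) = (x + 1, y)" for x y
    unfolding \<psi>(3) by (simp add: two_column_perm_def c_def)
  have shift: "\<psi> (\<lambda>t. 0, int m) (x, y) = (x + int m, y)" for m x y
  proof (induction m arbitrary: x)
    case 0
    have "\<psi> (\<lambda>t. 0, 0) = \<one>\<^bsub>?Q\<^esub>" using \<psi>.hom_one by (simp add: lamplighter_simps)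
    then show ?case by (simp add: BijGroup_def)
  next
    case (Suc m)
    have m: "(\<lambda>t. 0, int m) \<in> carrier lamplighter" by (simp add: lamplighter_simps)
    have "(\<lambda>t. 0, int (Suc m)) = (\<lambda>t. 0, int m) \<otimes>\<^bsub>lamplighter\<^esub> c"
      by (simp add: lamplighter_simps c_def add.commute)
    then have "\<psi> (\<lambda>t. 0, int (Suc m)) (x, y) = \<psi> (\<lambda>t. 0, int m) (\<psi> c (x, y))"
      using \<psi>_mult[OF m ac(2)] by simp
    then show ?case by (simp add: \<psi>c Suc.IH add.assoc)
  qed
  define d a' :: "(int \<Rightarrow> int) \<times> int" where "d = (\<lambda>t. 0, int n)" and "a' = (\<lambda>t. if t = int n then 1 else 0, 0)"
  have da': "d \<in> carrier lamplighter" "a' \<in> carrier lamplighter"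
    by (simp_all add: d_def a'_def lamplighter_simps)
  have "a' \<otimes>\<^bsub>lamplighter\<^esub> d = d \<otimes>\<^bsub>lamplighter\<^esub> a"
    by (auto simp: d_def a'_def a_def lamplighter_simps)
  then have "\<psi> a' (\<psi> d p) = \<psi> d (\<psi> a p)" for p
    using \<psi>_mult[OF da'(2,1)] \<psi>_mult[OF da'(1) ac(1)] by (metis comp_apply)
  from this[of "(0, y)" for y] have \<psi>a': "\<psi> a' (int n, y) = (int n, y + 1)" for y
    using n by (simp add: d_def shift \<psi>a)
  have "a \<otimes>\<^bsub>lamplighter\<^esub> a' = a' \<otimes>\<^bsub>lamplighter\<^esub> a"
    by (auto simp: a'_def a_def lamplighter_simps)
  then have "\<psi> a (\<psi> a' (int n, 0)) = \<psi> a' (\<psi> a (int n, 0))"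
    using \<psi>_mult[OF ac(1) da'(2)] \<psi>_mult[OF da'(2) ac(1)] by (metis comp_apply)
  then show False
    using n by (simp add: \<psi>a' \<psi>a twist_def)
qed

section \<open>The transition group of the comb graph\<close>

theorem proposition10p5:
  "transition_group comb_graph \<cong> wreath_product integer_group integer_group \<and>
   \<not> finitely_presented (transition_group comb_graph) \<and>
   solvable (transition_group comb_graph) \<and>
   (\<exists>H. subgroup H (transition_group comb_graph) \<and>
      (transition_group comb_graph)\<lparr>carrier := H\<rparr> \<cong> free_Abelian_group (UNIV :: nat set)) \<and>
   \<not> poly_context_free (transition_group comb_graph)"
proof -
  let ?G = "transition_group comb_graph"
  interpret G: group ?G by (rule group_transition_group_comb)
  interpret W: group lamplighter by (rule group_lamplighter)
  have iso: "?G \<cong> lamplighter" by (rule W.iso_sym[OF is_isoI[OF comb_perm_iso]])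
  have "\<not> finitely_presented ?G"
    using lamplighter_not_finitely_presented iso_trans[OF is_isoI[OF comb_perm_iso]]
    by (auto simp: finitely_presented_def)
  moreover have "solvable ?G"
    by (rule isomorphic_solvable[OF group_lamplighter G.is_group comb_perm_iso solvable_lamplighter])
  moreover have h: "comb_perm \<circ> coordinate_lamps \<in> hom (free_Abelian_group UNIV) ?G"
    using comb_perm_iso by (intro hom_compose[OF coordinate_lamps_hom]) (simp add: iso_def)
  moreover have inj: "inj (comb_perm \<circ> coordinate_lamps)"
    by (rule inj_compose[OF inj_comb_perm inj_coordinate_lamps])
  moreover have "\<exists>H. subgroup H ?G \<and> ?G\<lparr>carrier := H\<rparr> \<cong> free_Abelian_group (UNIV :: nat set)"
    using embedding_imp_isomorphic_subgroup[OF group_free_Abelian_group G.is_group h]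
      inj_on_subset[OF inj] by blast
  ultimately show ?thesis
    using iso G.infinite_rank_imp_not_poly_context_free by blast
qed

end
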